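(* Assume that $B=\operatorname{diag}(b_1^{-1}I_{n_1},b_2^{-1}I_{n_2},\dots,b_r^{-1}I_{n_r})$ is a nonsingular diagonal $n\times n$ matrix with $b_j\neq b_k$ for $j\neq k$, and $Q(x)=(q_{jk}(x))_{j,k=1}^r$, where $q_{jk}\in L^1([0,1];\mathbb{C}^{n_j\times n_k})$ and $q_{jj}\equiv0$, $j\in\{1,\dots,r\}$. Let $S$ be a sector strictly embedded into one of the sectors $S_p$ associated with the numbers $ib_1,\dots,ib_r$. Then the numbers $\{ib_j\}_1^r$ can be renumbered with respect to $S$ so that $$\operatorname{Re}(ib_{j_1}\lambda)<\operatorname{Re}(ib_{j_2}\lambda)<\dots<\operatorname{Re}(ib_{j_r}\lambda),\qquad\lambda\in S.$$ Moreover, for sufficiently large $R$, the equation $-iBy'+Q(x)y=\lambda y$ on $[0,1]$ has a fundamental system of matrix solutions $$Y_k(x;\lambda)=\begin{pmatrix}y_{1k}(x;\lambda)\\ y_{2k}(x;\lambda)\\ \vdots\\ y_{rk}(x;\lambda)\end{pmatrix},\qquad y_{jk}(\cdot;\lambda):[0,1]\to\mathbb{C}^{n_j\times n_k},\quad k\in\{1,\dots,r\},$$ which is analytic with respect to $\lambda\in S_R$ and has the asymptotic behavior (uniformly in $x\in[0,1]$, as $\lambda\to\infty$, $\lambda\in S_R$) $$y_{kk}(x;\lambda)=(I_{n_k}+o(1))e^{ib_k\lambda x},\qquad y_{jk}(x;\lambda)=o(1)e^{ib_k\lambda x}\ \text{ for } j\neq k.$$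
   Context: $n=n_1+\dots+n_r$, and the block decomposition of $Q$ is with respect to $\mathbb{C}^n=\mathbb{C}^{n_1}\oplus\dots\oplus\mathbb{C}^{n_r}$. Solutions are understood in the Carathéodory (absolutely continuous) sense. Sectors. For $j\neq k$ the set $\{\lambda\in\mathbb{C}:\operatorname{Re}(ib_j\lambda)=\operatorname{Re}(ib_k\lambda)\}$ is a line through the origin; all these lines divide the complex plane into finitely many open sectors $S_p=\{z:\varphi_{1p}<\arg z<\varphi_{2p}\}$ with vertex at the origin. A sector $S$ strictly embedded into $S_p$ is one of the form $S=\{z:\varphi_{1p}+\varepsilon_1<\arg z<\varphi_{2p}-\varepsilon_2\}$ with $\varepsilon_1,\varepsilon_2>0$, and $S_R:=\{z\in S:|z|>R\}$. *)

theory Defs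
  imports "HOL-Analysis.Analysis" "HOL-Combinatorics.Permutations"
begin

text \<open>
  The decomposition of the coordinate space \<open>complex ^ 'n\<close> into \<open>r\<close> blocks is encoded by a map \<open>blk\<close>
  from the coordinates (a finite type \<open>'n\<close>) to the block labels, with range \<open>{1..r}\<close>: block \<open>j\<close>
  consists of the coordinates \<open>i\<close> with \<open>blk i = j\<close>, and their number, which is positive, is the size
  of the block. The block \<open>(j, k)\<close> of a matrix \<open>M\<close> has the entries \<open>M $ i $ l\<close> with \<open>blk i = j\<close> and
  \<open>blk l = k\<close>; the columns \<open>l\<close> with \<open>blk l = k\<close> form the block column \<open>k\<close> (the matrix solution \<open>Y\<^sub>k\<close>).
\<close>

definition block_diag_inv :: "('n::finite \<Rightarrow> nat) \<Rightarrow> (nat \<Rightarrow> complex) \<Rightarrow> complex ^ 'n ^ 'n" where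
  "block_diag_inv blk b = (\<chi> i l. if i = l then inverse (b (blk i)) else 0)"


subsection \<open>Sectors\<close>

definition open_sector :: "real \<Rightarrow> real \<Rightarrow> complex set" where
  "open_sector \<phi>1 \<phi>2 = {complex_of_real \<rho> * cis \<theta> | \<rho> \<theta>. \<rho> > 0 \<and> \<phi>1 < \<theta> \<and> \<theta> < \<phi>2}"

definition separating_line :: "(nat \<Rightarrow> complex) \<Rightarrow> nat \<Rightarrow> nat \<Rightarrow> complex set" where
  "separating_line b j k = {lam. Re (\<i> * b j * lam) = Re (\<i> * b k * lam)}"

text \<open>
  The origin is removed explicitly only for the sake of \<open>r = 1\<close>, where there are no lines. The only
  component is then the punctured plane, which is \<open>open_sector \<phi>1 \<phi>2\<close> with \<open>\<phi>2 - \<phi>1 > 2 * pi\<close>.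
\<close>
definition is_sector_of :: "nat \<Rightarrow> (nat \<Rightarrow> complex) \<Rightarrow> real \<Rightarrow> real \<Rightarrow> bool" where
  "is_sector_of r b \<phi>1 \<phi>2 \<longleftrightarrow>
     open_sector \<phi>1 \<phi>2 \<in>
       components (UNIV - {0} - \<Union> {separating_line b j k | j k. j \<in> {1..r} \<and> k \<in> {1..r} \<and> j \<noteq> k})"

definition strictly_embedded_sector :: "nat \<Rightarrow> (nat \<Rightarrow> complex) \<Rightarrow> complex set \<Rightarrow> bool" where
  "strictly_embedded_sector r b S \<longleftrightarrow>
     (\<exists>\<phi>1 \<phi>2 \<epsilon>1 \<epsilon>2. is_sector_of r b \<phi>1 \<phi>2 \<and> \<epsilon>1 > 0 \<and> \<epsilon>2 > 0 \<and>
        \<phi>1 + \<epsilon>1 < \<phi>2 - \<epsilon>2 \<and> S = open_sector (\<phi>1 + \<epsilon>1) (\<phi>2 - \<epsilon>2))"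

definition outside_disc :: "complex set \<Rightarrow> real \<Rightarrow> complex set" where
  "outside_disc S R = {z \<in> S. norm z > R}"


subsection \<open>Absolutely continuous solutions and fundamental systems\<close>

definition absolutely_continuous_on_Icc ::
    "real \<Rightarrow> real \<Rightarrow> (real \<Rightarrow> 'a::real_normed_vector) \<Rightarrow> bool" where
  "absolutely_continuous_on_Icc a b f \<longleftrightarrow>
     (\<forall>\<epsilon>>0. \<exists>\<delta>>0. \<forall>P :: (real \<times> real) set.
        finite P \<and>
        (\<forall>(u, v) \<in> P. a \<le> u \<and> u \<le> v \<and> v \<le> b) \<and>
        pairwise (\<lambda>(u, v) (u', v'). {u<..<v} \<inter> {u'<..<v'} = {}) P \<and>
        (\<Sum>(u, v)\<in>P. v - u) < \<delta>
        \<longrightarrow> (\<Sum>(u, v)\<in>P. norm (f v - f u)) < \<epsilon>)"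

definition caratheodory_solution ::
    "complex ^ 'n ^ 'n \<Rightarrow> (real \<Rightarrow> complex ^ 'n ^ 'n) \<Rightarrow> complex \<Rightarrow> (real \<Rightarrow> complex ^ 'n::finite) \<Rightarrow> bool" where
  "caratheodory_solution B Q lam y \<longleftrightarrow>
     absolutely_continuous_on_Icc 0 1 y \<and>
     (AE x\<in>{0..1} in lebesgue. \<exists>y'.
        (y has_vector_derivative y') (at x within {0..1}) \<and>
        (- \<i>) *s (B *v y') + Q x *v y x = lam *s y x)"

text \<open>The columns of \<open>Y\<close> form a basis of the space of solutions on \<open>[0,1]\<close>.\<close>
definition fundamental_system ::
    "complex ^ 'n ^ 'n \<Rightarrow> (real \<Rightarrow> complex ^ 'n ^ 'n) \<Rightarrow> complex \<Rightarrow> (real \<Rightarrow> complex ^ 'n ^ 'n::finite) \<Rightarrow> bool" where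
  "fundamental_system B Q lam Y \<longleftrightarrow>
     (\<forall>l. caratheodory_solution B Q lam (\<lambda>x. column l (Y x))) \<and>
     (\<forall>y. caratheodory_solution B Q lam y \<longrightarrow>
        (\<exists>!c :: complex ^ 'n. \<forall>x\<in>{0..1}. y x = (\<Sum>l\<in>UNIV. c $ l *s column l (Y x))))"

end

theory Submission
  imports Defs "HOL-Complex_Analysis.Cauchy_Integral_Formula"
begin

text \<open>
  Column \<open>l\<close> is sought in the form \<open>w e\<^bsup>i b\<^sub>k \<lambda> x\<^esup>\<close> with \<open>k = blk l\<close>. The entries \<open>w\<^sub>i\<close> solve an integral equation
  whose kernels are \<open>e\<^bsup>i (b\<^sub>j - b\<^sub>k) \<lambda> (x - t)\<^esup>\<close>, \<open>j = blk i\<close>, integrated over \<open>[0, x]\<close> or over \<open>[x, 1]\<close>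
  according to the sign of \<open>Re (i (b\<^sub>j - b\<^sub>k) \<lambda>)\<close>, which is constant on the sector; so they are bounded by 1.
  For \<open>j \<noteq> k\<close> they even decay like \<open>e\<^bsup>- c |\<lambda>| |x - t|\<^esup>\<close>, so that against a fixed \<open>L\<^sup>1\<close> function these
  rows of the integral operator are small, uniformly in \<open>x\<close>. The rows of block \<open>k\<close> are merely bounded,
  but as the diagonal block of \<open>Q\<close> vanishes they see only the other rows. Hence the operator is a
  contraction in a weighted norm, the Neumann series converges uniformly in \<open>(\<lambda>, x)\<close>, and its sum is
  analytic in \<open>\<lambda>\<close> and tends to the unit vector \<open>e\<^sub>l\<close>. In particular \<open>Y(0)\<close> is close to the identity,
  and a Gronwall argument shows that every solution is determined by its value at 0.
\<close>

section \<open>Absolute continuity and indefinite integrals\<close>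

text \<open>Because \<open>Q\<close> is merely integrable, both halves of Lebesgue's fundamental
  theorem of calculus are needed. Existence rests on the fact that an indefinite integral is
  absolutely continuous with the integrand as its derivative almost everywhere. Uniqueness rests on
  the converse: an absolutely continuous function is the integral of its derivative, so any solution
  satisfies an integral equation to which Gronwall applies. The obstacle to a plain contraction is
  that the rows of block k have operator norm up to the total mass \<open>G\<close> of the
  coefficients, and no choice of R lowers it. They read only the other rows, however, so giving
  those a small weight beats \<open>G\<close>; the price is that the other rows must be made smaller
  than that weight, which is what fixes R. Strict embedding enters through a constant c > 0 with |Re
  (i (b_j - b_k) \<lambda>)| \<ge> c |\<lambda>| on the sector. The construction runs on a larger
  open set, where this holds with c/2 and |\<lambda>| > R: openness is immediate there, and
  analyticity on the part of the sector follows by restriction.\<close>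

lemma negligible_outer_open:
  fixes N :: "'a::euclidean_space set"
  assumes "negligible N" "e > 0"
  obtains U where "open U" "N \<subseteq> U" "U \<in> lmeasurable" "measure lebesgue U < e"
proof -
  obtain U where U: "open U" "N \<subseteq> U" "U - N \<in> lmeasurable" "emeasure lebesgue (U - N) < ennreal e"
    using sets_lebesgue_outer_open[of N e] assms negligible_imp_sets by metis
  have eq: "U = (U - N) \<union> N" using U by blast
  have UL: "U \<in> lmeasurable"
    by (subst eq) (use U assms negligible_imp_measurable in blast)
  have "measure lebesgue U = measure lebesgue (U - N)"
    by (rule measure_negligible_symdiff[symmetric])
       (use assms(1) U(2) UL in \<open>auto intro: negligible_subset\<close>)
  moreover have "measure lebesgue (U - N) < e"
    using U(3,4) assms(2) by (simp add: emeasure_eq_measure2 ennreal_less_iff)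
  ultimately show ?thesis using U UL that by simp
qed

definition subinterval_family :: "real \<Rightarrow> real \<Rightarrow> (real \<times> real) set \<Rightarrow> bool" where
  "subinterval_family a b P \<longleftrightarrow> finite P \<and> (\<forall>(u, v) \<in> P. a \<le> u \<and> u \<le> v \<and> v \<le> b) \<and>
     pairwise (\<lambda>(u, v) (u', v'). {u<..<v} \<inter> {u'<..<v'} = {}) P"

lemma absolutely_continuous_on_Icc_iff:
  "absolutely_continuous_on_Icc a b f \<longleftrightarrow>
     (\<forall>e>0. \<exists>\<delta>>0. \<forall>P. subinterval_family a b P \<longrightarrow> (\<Sum>(u, v)\<in>P. v - u) < \<delta> \<longrightarrow>
        (\<Sum>(u, v)\<in>P. norm (f v - f u)) < e)"
  unfolding absolutely_continuous_on_Icc_def subinterval_family_def by (simp only: conj_assoc imp_conjL)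

lemma absolutely_continuous_on_IccE:
  assumes "absolutely_continuous_on_Icc a b f" "e > 0"
  obtains \<delta> where "\<delta> > 0" "\<And>P. subinterval_family a b P \<Longrightarrow> (\<Sum>(u, v)\<in>P. v - u) < \<delta> \<Longrightarrow>
      (\<Sum>(u, v)\<in>P. norm (f v - f u)) < e"
  using assms unfolding absolutely_continuous_on_Icc_iff by blast

text \<open>
  Tags outside \<open>N\<close> are controlled by the derivative; the intervals tagged in \<open>N\<close> can be kept inside an
  open set of small measure, where absolute continuity takes over.
\<close>
lemma absolutely_continuous_has_integral:
  fixes f g :: "real \<Rightarrow> 'a::euclidean_space"
  assumes ab: "a \<le> b" and AC: "absolutely_continuous_on_Icc a b f"
    and N: "negligible N"
    and der: "\<And>x. x \<in> {a..b} - N \<Longrightarrow> (f has_vector_derivative g x) (at x within {a..b})"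
  shows "(g has_integral f b - f a) {a..b}"
proof -
  \<comment> \<open>Changing \<open>g\<close> on \<open>N\<close> leaves the integral alone and
    removes the Riemann terms tagged in \<open>N\<close>; only the increments of \<open>f\<close>
    remain there.\<close>
  define h where "h x = (if x \<in> N then 0 else g x)" for x
  have "(h has_integral f b - f a) {a..b}"
    unfolding has_integral_real
  proof (intro allI impI)
    fix e :: real assume e: "e > 0"
    obtain \<delta> where \<delta>: "\<delta> > 0" "\<And>P. subinterval_family a b P \<Longrightarrow> (\<Sum>(u, v)\<in>P. v - u) < \<delta> \<Longrightarrow>
        (\<Sum>(u, v)\<in>P. norm (f v - f u)) < e/2"
      using absolutely_continuous_on_IccE[OF AC half_gt_zero[OF e]] by blast
    obtain U where U: "open U" "N \<subseteq> U" "U \<in> lmeasurable" "measure lebesgue U < \<delta>"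
      using negligible_outer_open[OF N \<delta>(1)] .
    \<comment> \<open>Half of \<open>e\<close> spread over the length of the interval; the 1 covers
      \<open>a = b\<close>.\<close>
    define e' where "e' = e / (2 * (b - a + 1))"
    have e': "e' > 0" "e' * (b - a) < e/2" using e ab by (auto simp: e'_def field_simps)
    have "\<exists>d>0. x \<in> {a..b} \<longrightarrow> (x \<in> N \<longrightarrow> ball x d \<subseteq> U) \<and> (x \<notin> N \<longrightarrow> (\<forall>y\<in>{a..b}. \<bar>y - x\<bar> < d \<longrightarrow>
        norm (f y - f x - (y - x) *\<^sub>R g x) \<le> e' * \<bar>y - x\<bar>))" for x
    proof (cases "x \<in> N \<or> x \<notin> {a..b}")
      case True
      then show ?thesis using openE[OF U(1), of x] U(2) by (cases "x \<in> {a..b}") (metis subsetD, auto intro: zero_less_one)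
    next
      case False
      then show ?thesis using der[of x] e' unfolding has_vector_derivative_def has_derivative_within_alt
        by (auto simp: real_norm_def)
    qed
    then obtain d where d: "\<And>x. d x > 0" "\<And>x. x \<in> {a..b} \<Longrightarrow> x \<in> N \<Longrightarrow> ball x (d x) \<subseteq> U"
      "\<And>x y. x \<in> {a..b} \<Longrightarrow> x \<notin> N \<Longrightarrow> y \<in> {a..b} \<Longrightarrow> \<bar>y - x\<bar> < d x \<Longrightarrow>
        norm (f y - f x - (y - x) *\<^sub>R g x) \<le> e' * \<bar>y - x\<bar>"
      by metis
    show "\<exists>\<gamma>. gauge \<gamma> \<and> (\<forall>\<D>. \<D> tagged_division_of {a..b} \<and> \<gamma> fine \<D> \<longrightarrow>
        norm ((\<Sum>(x, k)\<in>\<D>. measure lborel k *\<^sub>R h x) - (f b - f a)) < e)"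
    proof (intro exI[of _ "\<lambda>x. ball x (d x)"] conjI allI impI)
      show "gauge (\<lambda>x. ball x (d x))" using d(1) gauge_ball_dependent by blast
      fix p assume "p tagged_division_of {a..b} \<and> (\<lambda>x. ball x (d x)) fine p"
      then have p: "p tagged_division_of {a..b}" and fine: "(\<lambda>x. ball x (d x)) fine p" by auto
      note pD = tagged_division_ofD[OF p]
      have ivl: "k = {Inf k..Sup k} \<and> a \<le> Inf k \<and> Inf k \<le> x \<and> x \<le> Sup k \<and> Sup k \<le> b \<and> measure lborel k = Sup k - Inf k"
        if xk: "(x, k) \<in> p" for x k
      proof -
        obtain u v where k: "k = {u..v}" using pD(4)[OF xk] by (auto simp: cbox_interval)
        then show ?thesis using pD(2,3)[OF xk] by auto
      qed
      define pN where "pN = {(x,k) \<in> p. x \<in> N}"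
      have pN: "pN \<subseteq> p" by (auto simp: pN_def)
      have fin: "finite p" "finite pN" using pD(1) pN finite_subset by auto
      have disj: "{Inf k<..<Sup k} \<inter> {Inf k'<..<Sup k'} = {}"
        if "(x,k) \<in> p" "(x',k') \<in> p" "(x,k) \<noteq> (x',k')" for x k x' k'
      proof -
        have "interior k \<inter> interior k' = {}" using pD(5)[OF that] .
        moreover have "interior k = {Inf k<..<Sup k}" "interior k' = {Inf k'<..<Sup k'}"
          using ivl[OF that(1)] ivl[OF that(2)] interior_atLeastAtMost_real by metis+
        ultimately show ?thesis by simp
      qed
      define m where "m = (\<lambda>(x::real,k::real set). (Inf k, Sup k))"
      \<comment> \<open>Absolute continuity speaks of a set of intervals, so the sum over tagged
        pieces must be reindexed. Two different pieces on one interval would have disjoint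
        interiors; the interval is then a single point and the tags agree after all.\<close>
      have inj: "inj_on m pN"
      proof (rule inj_onI, clarify)
        fix x k x' k' assume *: "(x,k) \<in> pN" "(x',k') \<in> pN" "m (x,k) = m (x',k')"
        then have **: "(x,k) \<in> p" "(x',k') \<in> p" and eq: "Inf k = Inf k'" "Sup k = Sup k'"
          using pN by (auto simp: m_def)
        then have kk: "k = k'" using ivl by metis
        show "x = x' \<and> k = k'"
        proof (rule ccontr)
          assume "\<not> (x = x' \<and> k = k')"
          then have "{Inf k<..<Sup k} = {}" using disj[OF **] eq by auto
          then have "Inf k = Sup k" using ivl[OF **(1)] by auto
          then show False using ivl[OF **(1)] ivl[OF **(2)] eq kk \<open>\<not> (x = x' \<and> k = k')\<close> by auto
        qed
      qed
      have "(\<Sum>(u, v)\<in>m ` pN. norm (f v - f u)) < e/2"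
      proof (rule \<delta>(2), unfold subinterval_family_def, intro conjI)
        show "finite (m ` pN)" using fin by simp
        show "\<forall>(u, v)\<in>m ` pN. a \<le> u \<and> u \<le> v \<and> v \<le> b"
          using pN ivl by (fastforce simp: m_def)
        show "pairwise (\<lambda>(u, v) (u', v'). {u<..<v} \<inter> {u'<..<v'} = {}) (m ` pN)"
        proof (rule pairwiseI)
          fix z z' assume z: "z \<in> m ` pN" "z' \<in> m ` pN" "z \<noteq> z'"
          then obtain x k x' k' where xk: "(x,k) \<in> pN" "(x',k') \<in> pN" "z = (Inf k, Sup k)" "z' = (Inf k', Sup k')"
            by (auto simp: m_def)
          then have "(x,k) \<noteq> (x',k')" using z by auto
          then show "(\<lambda>(u, v) (u', v'). {u<..<v} \<inter> {u'<..<v'} = {}) z z'"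
            using disj[of x k x' k'] xk pN by auto
        qed
        have "(\<Sum>(u, v)\<in>m ` pN. v - u) = (\<Sum>(x,k)\<in>pN. Sup k - Inf k)"
          by (subst sum.reindex[OF inj]) (auto simp: m_def intro!: sum.cong)
        also have "\<dots> = (\<Sum>(x,k)\<in>pN. measure lebesgue k)"
        proof (rule sum.cong[OF refl], clarify)
          fix x k assume "(x,k) \<in> pN"
          then have "measure lborel k = Sup k - Inf k" using ivl pN by blast
          moreover have "k \<in> sets lborel" 
          proof -
            have "(x,k) \<in> p" using \<open>(x,k) \<in> pN\<close> pN by blast
            then obtain u v where "k = cbox u v" using pD(4) by blast
            then show ?thesis by simp
          qed
          ultimately show "Sup k - Inf k = measure lebesgue k" by (simp add: measure_completion)
        qed
        \<comment> \<open>Pieces overlap at most in endpoints, so lengths add up to the measure of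
          the union, which fineness keeps inside \<open>U\<close>.\<close>
        also have "\<dots> = measure lebesgue (\<Union>(snd ` pN))"
        proof (subst measure_negligible_finite_Union_image)
          show "finite pN" by fact
          show "snd z \<in> lmeasurable" if "z \<in> pN" for z
          proof -
            have "z \<in> p" using that pN by auto
            then show ?thesis using pD(4)[of "fst z" "snd z"] by auto
          qed
          show "pairwise (\<lambda>x y. negligible (snd x \<inter> snd y)) pN"
          proof (rule pairwiseI)
            fix z z' assume z: "z \<in> pN" "z' \<in> pN" "z \<noteq> z'"
            obtain x k x' k' where zz: "z = (x,k)" "z' = (x',k')" by fastforce
            then have **: "(x,k) \<in> p" "(x',k') \<in> p" "(x,k) \<noteq> (x',k')" using z pN by auto
            have "k \<inter> k' \<subseteq> {Inf k, Sup k, Inf k', Sup k'}"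
            proof
              fix t assume t: "t \<in> k \<inter> k'"
              have "t \<in> {Inf k..Sup k}" "t \<in> {Inf k'..Sup k'}" using t ivl[OF **(1)] ivl[OF **(2)] by blast+
              then show "t \<in> {Inf k, Sup k, Inf k', Sup k'}" using disj[OF **] by fastforce
            qed
            then show "negligible (snd z \<inter> snd z')" unfolding zz snd_conv
              by (rule negligible_subset[rotated]) (simp add: negligible_finite)
          qed
        qed (auto simp: split_def)
        also have "\<dots> \<le> measure lebesgue U"
        proof (rule measure_mono_fmeasurable)
          show "\<Union>(snd ` pN) \<subseteq> U"
          proof
            fix t assume "t \<in> \<Union>(snd ` pN)"
            then obtain x k where "t \<in> k" "(x,k) \<in> pN" by auto
            moreover from this have "x \<in> N" "(x,k) \<in> p" "x \<in> {a..b}" "k \<subseteq> ball x (d x)"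
              using fine pD(2,3)[of x k] unfolding pN_def fine_def by blast+
            ultimately show "t \<in> U" using d(2)[of x] by blast
          qed
          show "\<Union>(snd ` pN) \<in> sets lebesgue" 
          proof (rule sets.finite_Union)
            show "snd ` pN \<subseteq> sets lebesgue"
              using pD(4) pN by (fastforce)
          qed (use fin in auto)
        qed (use U in auto)
        finally show "(\<Sum>(u, v)\<in>m ` pN. v - u) < \<delta>" using U by simp
      qed
      moreover have "(\<Sum>(u, v)\<in>m ` pN. norm (f v - f u)) = (\<Sum>(x,k)\<in>pN. norm (f (Sup k) - f (Inf k)))"
        by (subst sum.reindex[OF inj]) (auto simp: m_def intro!: sum.cong)
      moreover have "(\<Sum>(x,k)\<in>pN. norm (measure lborel k *\<^sub>R h x - (f (Sup k) - f (Inf k)))) = (\<Sum>(x,k)\<in>pN. norm (f (Sup k) - f (Inf k)))"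
        by (rule sum.cong) (auto simp: pN_def h_def norm_minus_commute)
      ultimately have 1: "(\<Sum>(x,k)\<in>pN. norm (measure lborel k *\<^sub>R h x - (f (Sup k) - f (Inf k)))) < e/2" by simp
      have "(\<Sum>(x,k)\<in>p - pN. norm (measure lborel k *\<^sub>R h x - (f (Sup k) - f (Inf k)))) \<le> (\<Sum>(x,k)\<in>p - pN. e' * measure lborel k)"
      proof (rule sum_mono, clarify)
        fix x k assume xk: "(x,k) \<in> p" "(x,k) \<notin> pN"
        then have xN: "x \<notin> N" by (auto simp: pN_def)
        note i = ivl[OF xk(1)]
        have "Inf k \<in> k" "Sup k \<in> k" using i by (metis atLeastAtMost_iff order_refl order_trans)+
        moreover have "k \<subseteq> ball x (d x)" using fine xk(1) unfolding fine_def by blast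
        ultimately have "\<bar>Inf k - x\<bar> < d x" "\<bar>Sup k - x\<bar> < d x"
          using mem_ball[of x "d x"] by (auto simp: dist_real_def abs_minus_commute subset_eq)
        then have "norm (f (Sup k) - f x - (Sup k - x) *\<^sub>R g x) \<le> e' * (Sup k - x)"
          "norm (f (Inf k) - f x - (Inf k - x) *\<^sub>R g x) \<le> e' * (x - Inf k)"
          using d(3)[of x "Sup k"] d(3)[of x "Inf k"] i xN by auto
        \<comment> \<open>Straddle estimate: the tag lies between the endpoints, so the
          linearisation errors at the two ends add up to at most \<open>e'\<close> times the
          length.\<close>
        moreover have eq: "measure lborel k *\<^sub>R h x - (f (Sup k) - f (Inf k)) =
            (f (Inf k) - f x - (Inf k - x) *\<^sub>R g x) - (f (Sup k) - f x - (Sup k - x) *\<^sub>R g x)"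
        proof -
          have 1: "measure lborel k = Sup k - Inf k" "h x = g x" using i xN by (auto simp: h_def)
          show ?thesis unfolding 1 by (simp add: algebra_simps)
        qed
        ultimately have "norm (measure lborel k *\<^sub>R h x - (f (Sup k) - f (Inf k))) \<le> e' * (Sup k - x) + e' * (x - Inf k)"
          using norm_triangle_ineq4[of "f (Inf k) - f x - (Inf k - x) *\<^sub>R g x" "f (Sup k) - f x - (Sup k - x) *\<^sub>R g x"]
          unfolding eq by linarith
        also have "\<dots> = e' * (Sup k - Inf k)" by (simp add: algebra_simps)
        finally show "norm (measure lborel k *\<^sub>R h x - (f (Sup k) - f (Inf k))) \<le> e' * measure lborel k"
          using i by simp
      qed
      also have "\<dots> \<le> (\<Sum>(x,k)\<in>p. e' * measure lborel k)"
        by (rule sum_mono2) (use fin e' in auto)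
      also have "\<dots> = e' * (b - a)"
        using additive_content_tagged_division[of p a b] p ab
        by (simp add: split_def sum_distrib_left[symmetric] cbox_interval)
      finally have 2: "(\<Sum>(x,k)\<in>p - pN. norm (measure lborel k *\<^sub>R h x - (f (Sup k) - f (Inf k)))) < e/2" using e' by simp
      have "(\<Sum>(x, k)\<in>p. measure lborel k *\<^sub>R h x) - (f b - f a) = (\<Sum>(x,k)\<in>p. measure lborel k *\<^sub>R h x - (f (Sup k) - f (Inf k)))"
        using additive_tagged_division_1[OF ab p, of f] by (simp add: split_def sum_subtractf)
      also have "norm \<dots> \<le> (\<Sum>(x,k)\<in>p. norm (measure lborel k *\<^sub>R h x - (f (Sup k) - f (Inf k))))"
        by (rule sum_norm_le) auto
      also have "\<dots> = (\<Sum>(x,k)\<in>p-pN. norm (measure lborel k *\<^sub>R h x - (f (Sup k) - f (Inf k)))) + (\<Sum>(x,k)\<in>pN. norm (measure lborel k *\<^sub>R h x - (f (Sup k) - f (Inf k))))"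
        by (rule sum.subset_diff) (use pN fin in auto)
      finally show "norm ((\<Sum>(x, k)\<in>p. measure lborel k *\<^sub>R h x) - (f b - f a)) < e" using 1 2 by linarith
    qed
  qed
  then show ?thesis
    by (rule has_integral_spike[OF N, rotated]) (auto simp: h_def)
qed

lemma integral_difference_real:
  fixes f :: "real \<Rightarrow> 'a::banach"
  assumes "f integrable_on {a..b}" "a \<le> u" "u \<le> v" "v \<le> b"
  shows "integral {a..v} f - integral {a..u} f = integral {u..v} f"
proof -
  have "f integrable_on {a..v}" using assms integrable_on_subinterval by fastforce
  then show ?thesis using Henstock_Kurzweil_Integration.integral_combine[of a u v f] assms by (simp add: algebra_simps)
qed

lemma absolutely_integrable_continuous_mult:
  fixes f g :: "real \<Rightarrow> 'a::{euclidean_space,real_normed_algebra}"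
  assumes "continuous_on {a..b} f" "g absolutely_integrable_on {a..b}"
  shows "(\<lambda>x. f x * g x) absolutely_integrable_on {a..b}"
proof (rule absolutely_integrable_bounded_measurable_product[OF bilinear_times _ _ _ assms(2)])
  show "f \<in> borel_measurable (lebesgue_on {a..b})"
    by (rule continuous_imp_measurable_on_sets_lebesgue[OF assms(1)]) simp
  show "bounded (f ` {a..b})"
    using assms(1) compact_continuous_image compact_imp_bounded by blast
qed simp

text \<open>
  On a Vitali family of intervals that violate differentiability by a factor \<open>c\<close>, Henstock's lemma
  bounds \<open>c\<close> times the total length.
\<close>
lemma indefinite_integral_has_vector_derivative_ae:
  fixes f :: "real \<Rightarrow> 'a::euclidean_space"
  assumes int: "f integrable_on {a..b}"
  obtains N where "negligible N"
    "\<And>x. x \<in> {a..b} - N \<Longrightarrow> ((\<lambda>u. integral {a..u} f) has_vector_derivative f x) (at x within {a..b})"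
proof -
  define F where "F u = integral {a..u} f" for u
  define D where "D x y = norm (F y - F x - (y - x) *\<^sub>R f x)" for x y
  \<comment> \<open>Points where the difference quotient misses \<open>f x\<close> by more than
    \<open>c\<close> at arbitrarily small scales. Off the union of these sets over c = 1/(n+1), the
    derivative is \<open>f x\<close>.\<close>
  define E where "E c = {x \<in> {a..b}. \<forall>d>0. \<exists>y\<in>{a..b}. \<bar>y - x\<bar> < d \<and> D x y > c * \<bar>y - x\<bar>}" for c
  have notE: "\<exists>d>0. \<forall>y\<in>{a..b}. \<bar>y - x\<bar> < d \<longrightarrow> D x y \<le> c * \<bar>y - x\<bar>" if "x \<in> {a..b}" "x \<notin> E c" for c x
    using that unfolding E_def mem_Collect_eq by (meson not_le)
  have neg: "negligible (E c)" if c: "c > 0" for c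
    unfolding negligible_outer_le
  proof (intro allI impI)
    fix e :: real assume e: "e > 0"
    obtain \<gamma> where \<gamma>: "gauge \<gamma>" "\<And>p. p tagged_partial_division_of (cbox a b) \<Longrightarrow> \<gamma> fine p \<Longrightarrow>
        (\<Sum>(x,k)\<in>p. norm (measure lborel k *\<^sub>R f x - integral k f)) < c * e"
      using Henstock_lemma[of f a b "c * e"] int e c by auto
    \<comment> \<open>A pair \<open>(x, y)\<close> stands for the interval between \<open>x\<close>
      and \<open>y\<close> with tag \<open>x\<close>; writing it as a ball makes Vitali's theorem
      for balls applicable.\<close>
    define ce where "ce = (\<lambda>(x::real,y). (x + y) / 2)"
    define ra where "ra = (\<lambda>(x::real,y). \<bar>y - x\<bar> / 2)"
    have cb: "cball (ce (x,y)) (ra (x,y)) = {min x y..max x y}" for x y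
    proof -
      have "ce (x,y) - ra (x,y) = min x y" "ce (x,y) + ra (x,y) = max x y"
        by (auto simp: ce_def ra_def min_def max_def field_simps)
      then show ?thesis by (simp add: cball_eq_atLeastAtMost)
    qed
    \<comment> \<open>The last condition builds fineness into the family before the Vitali selection
      is made.\<close>
    define K where "K = {(x,y). x \<in> {a..b} \<and> y \<in> {a..b} \<and> x \<noteq> y \<and> D x y > c * \<bar>y - x\<bar> \<and> {min x y..max x y} \<subseteq> \<gamma> x}"
    have cov: "\<exists>i. i \<in> K \<and> x \<in> cball (ce i) (ra i) \<and> ra i < d" if x: "x \<in> E c" and d: "d > 0" for x d
    proof -
      obtain \<delta> where \<delta>: "\<delta> > 0" "ball x \<delta> \<subseteq> \<gamma> x" using \<gamma>(1) by (meson gaugeD openE)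
      obtain y where y: "y \<in> {a..b}" "\<bar>y - x\<bar> < min d \<delta>" "D x y > c * \<bar>y - x\<bar>"
      proof -
        have "\<forall>d>0. \<exists>y\<in>{a..b}. \<bar>y - x\<bar> < d \<and> D x y > c * \<bar>y - x\<bar>" using x by (simp add: E_def)
        moreover have "min d \<delta> > 0" using d \<delta>(1) by simp
        ultimately show ?thesis using that by blast
      qed
      have "x \<noteq> y" using y by (auto simp: D_def)
      moreover have "{min x y..max x y} \<subseteq> ball x \<delta>" using y(2) by (auto simp: dist_real_def)
      ultimately have "(x,y) \<in> K" using y x \<delta> by (auto simp: K_def E_def)
      moreover have "x \<in> cball (ce (x,y)) (ra (x,y))" unfolding cb by auto
      moreover have "ra (x,y) < d" using y d by (auto simp: ra_def)
      ultimately show ?thesis by blast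
    qed
    have rpos: "\<And>i. i \<in> K \<Longrightarrow> 0 < ra i" by (auto simp: K_def ra_def)
    obtain C where C: "countable C" "C \<subseteq> K"
       "pairwise (\<lambda>i j. disjnt (cball (ce i) (ra i)) (cball (ce j) (ra j))) C"
       "negligible (E c - (\<Union>i \<in> C. cball (ce i) (ra i)))"
      by (rule Vitali_covering_theorem_cballs[of K ra "E c" ce, OF rpos cov])
    \<comment> \<open>Henstock's lemma concerns finite partial divisions; a bound common to all
      finite subfamilies then carries over to the countable union.\<close>
    have bnd: "measure lebesgue (\<Union>i\<in>I. cball (ce i) (ra i)) \<le> e" if I: "I \<subseteq> C" "finite I" for I
    proof -
      define p where "p = (\<lambda>i. (fst i, cball (ce i) (ra i))) ` I"
      have IK: "I \<subseteq> K" using I C by auto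
      have ne: "cball (ce i) (ra i) \<noteq> {}" if "i \<in> I" for i using rpos[of i] that IK by force
      have disj: "cball (ce i) (ra i) \<inter> cball (ce j) (ra j) = {}" if "i \<in> I" "j \<in> I" "i \<noteq> j" for i j
        using pairwiseD[OF C(3), of i j] that I by (simp add: disjnt_def) blast
      have inj: "inj_on (\<lambda>i. (fst i, cball (ce i) (ra i))) I"
        
      proof (rule inj_onI, rule ccontr)
        fix i j assume ij: "i \<in> I" "j \<in> I" "i \<noteq> j"
          and "(fst i, cball (ce i) (ra i)) = (fst j, cball (ce j) (ra j))"
        then have "cball (ce i) (ra i) = cball (ce j) (ra j)" by blast
        then show False using disj[OF ij] ne[OF ij(1)] by blast
      qed
      have tp: "p tagged_partial_division_of (cbox a b)"
        unfolding tagged_partial_division_of_def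
      proof (intro conjI allI impI)
        show "finite p" using I by (simp add: p_def)
        fix x k assume "(x,k) \<in> p"
        then obtain y where i: "(x,y) \<in> I" "k = {min x y..max x y}" by (auto simp: p_def cb)
        then show "x \<in> k" "k \<subseteq> cbox a b" "\<exists>a b. k = cbox a b" using IK by (auto simp: K_def)
      next
        fix x k x' k' assume "(x,k) \<in> p \<and> (x',k') \<in> p \<and> (x,k) \<noteq> (x',k')"
        then have "k \<inter> k' = {}" using disj by (fastforce simp: p_def)
        then show "interior k \<inter> interior k' = {}" using interior_subset by fast
      qed
      have fine: "\<gamma> fine p" unfolding fine_def
      proof (clarify)
        fix x k t assume "(x,k) \<in> p" and t: "t \<in> k"
        then obtain y where "(x,y) \<in> I" "k = {min x y..max x y}" by (auto simp: p_def cb)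
        then show "t \<in> \<gamma> x" using IK t unfolding K_def by blast
      qed
      have *: "c * measure lborel (cball (ce i) (ra i)) \<le> norm (measure lborel (cball (ce i) (ra i)) *\<^sub>R f (fst i) - integral (cball (ce i) (ra i)) f)"
        if "i \<in> I" for i
      proof -
        obtain x y where i: "i = (x,y)" by (cases i)
        then have xy: "x \<in> {a..b}" "y \<in> {a..b}" "D x y > c * \<bar>y - x\<bar>" using that IK by (auto simp: K_def)
        show ?thesis
        proof (cases "x \<le> y")
          case True
          then have "integral {x..y} f = F y - F x" using integral_difference_real[OF int] xy by (simp add: F_def)
          then show ?thesis using xy True unfolding i cb by (simp add: D_def norm_minus_commute)
        next
          case False
          then have "integral {y..x} f = F x - F y" using integral_difference_real[OF int] xy by (simp add: F_def)
          moreover have "(x - y) *\<^sub>R f x - (F x - F y) = F y - F x - (y - x) *\<^sub>R f x" by (simp add: algebra_simps)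
          then have "norm ((x - y) *\<^sub>R f x - (F x - F y)) = D x y" unfolding D_def by (rule arg_cong)
          ultimately show ?thesis using xy False unfolding i cb by simp
        qed
      qed
      have "c * measure lebesgue (\<Union>i\<in>I. cball (ce i) (ra i)) = (\<Sum>i\<in>I. c * measure lborel (cball (ce i) (ra i)))"
        by (subst measure_negligible_finite_Union_image)
           (use I disj in \<open>auto simp: pairwise_def sum_distrib_left\<close>)
      also have "\<dots> \<le> (\<Sum>i\<in>I. norm (measure lborel (cball (ce i) (ra i)) *\<^sub>R f (fst i) - integral (cball (ce i) (ra i)) f))"
        by (rule sum_mono) (rule *)
      also have "\<dots> = (\<Sum>(x,k)\<in>p. norm (measure lborel k *\<^sub>R f x - integral k f))"
        unfolding p_def by (subst sum.reindex[OF inj]) simp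
      also have "\<dots> < c * e" by (rule \<gamma>(2)[OF tp fine])
      finally show ?thesis using c by simp
    qed
    define W where "W = (\<Union>i\<in>C. cball (ce i) (ra i))"
    have W: "W \<in> lmeasurable" "measure lebesgue W \<le> e"
      unfolding W_def by (rule fmeasurable_UN_bound measure_UN_bound; use C bnd in auto)+
    define T where "T = (E c - W) \<union> W"
    have nW: "negligible (E c - W)" using C(4) by (simp add: W_def)
    have "T \<in> lmeasurable" unfolding T_def using nW W negligible_imp_measurable by blast
    moreover have "measure lebesgue T = measure lebesgue W"
      unfolding T_def by (rule measure_negligible_symdiff[OF W(1)]) (rule negligible_subset[OF nW], auto)
    ultimately show "\<exists>T. E c \<subseteq> T \<and> T \<in> lmeasurable \<and> measure lebesgue T \<le> e"
      using W(2) by (intro exI[of _ T]) (auto simp: T_def)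
  qed
  show ?thesis
  proof
    show "negligible (\<Union>n. E (inverse (real (Suc n))))" by (rule negligible_Union_nat) (simp add: neg)
    fix x assume x: "x \<in> {a..b} - (\<Union>n. E (inverse (real (Suc n))))"
    show "((\<lambda>u. integral {a..u} f) has_vector_derivative f x) (at x within {a..b})"
      unfolding has_vector_derivative_def has_derivative_within_alt
    proof (intro conjI allI impI)
      show "bounded_linear (\<lambda>h. h *\<^sub>R f x)" by (rule bounded_linear_scaleR_left)
      fix e :: real assume "e > 0"
      then obtain n where n: "inverse (real (Suc n)) < e" using reals_Archimedean by blast
      have "x \<notin> E (inverse (real (Suc n)))" using x by blast
      then obtain d where d: "d > 0" "\<And>y. y \<in> {a..b} \<Longrightarrow> \<bar>y - x\<bar> < d \<Longrightarrow> D x y \<le> inverse (real (Suc n)) * \<bar>y - x\<bar>"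
        using notE[of x "inverse (real (Suc n))"] x by blast
      have "D x y \<le> e * norm (y - x)" if "y \<in> {a..b}" "norm (y - x) < d" for y
      proof -
        have "inverse (real (Suc n)) * \<bar>y - x\<bar> \<le> e * \<bar>y - x\<bar>" using n by (intro mult_right_mono) auto
        then show ?thesis using d(2)[of y] that unfolding real_norm_def by linarith
      qed
      then show "\<exists>d>0. \<forall>y\<in>{a..b}. norm (y - x) < d \<longrightarrow>
          norm (integral {a..y} f - integral {a..x} f - (y - x) *\<^sub>R f x) \<le> e * norm (y - x)"
        using d(1) unfolding D_def F_def by (intro exI[of _ d]) simp
    qed
  qed
qed

text \<open>Truncation: the part of \<open>norm f\<close> above a height \<open>n\<close> has
  integral below \<open>e/2\<close> for large \<open>n\<close> by dominated convergence, and the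
  part below contributes at most \<open>n\<close> times the total length of the intervals.\<close>

lemma absolutely_continuous_on_Icc_indefinite_integral:
  fixes f :: "real \<Rightarrow> 'a::euclidean_space"
  assumes f: "f absolutely_integrable_on {a..b}"
  shows "absolutely_continuous_on_Icc a b (\<lambda>x. integral {a..x} f)"
  unfolding absolutely_continuous_on_Icc_def
proof (intro allI impI)
  fix e :: real assume e: "e > 0"
  define h where "h t = norm (f t)" for t
  define hn where "hn n t = min (h t) (real n)" for n t
  have fi: "f integrable_on {a..b}" using f set_lebesgue_integral_eq_integral(1) by blast
  have h: "h absolutely_integrable_on {a..b}"
    using absolutely_integrable_norm[OF f] unfolding h_def[abs_def] o_def .
  have hi: "h integrable_on {a..b}" using h set_lebesgue_integral_eq_integral(1) by blast
  have hn: "hn n integrable_on {a..b}" for n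
  proof -
    have "(\<lambda>t. min (h t) (real n)) absolutely_integrable_on {a..b}"
      by (rule absolutely_integrable_min_1[OF h absolutely_integrable_continuous_real]) simp
    then show ?thesis unfolding hn_def[abs_def] by (rule set_lebesgue_integral_eq_integral(1))
  qed
  have "(\<lambda>n. integral {a..b} (hn n)) \<longlonglongrightarrow> integral {a..b} h"
  proof (rule dominated_convergence(2)[OF hn hi])
    show "norm (hn n x) \<le> h x" for n x by (auto simp: hn_def h_def)
    fix x
    obtain N where N: "h x \<le> real N" using real_arch_simple by blast
    have "\<forall>\<^sub>F n in sequentially. hn n x = h x"
      using eventually_ge_at_top[of N]
    proof eventually_elim
      case (elim n)
      then have "real N \<le> real n" by simp
      with N show ?case by (simp add: hn_def)
    qed
    then show "(\<lambda>n. hn n x) \<longlonglongrightarrow> h x" by (rule tendsto_eventually)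
  qed
  then obtain n where n: "\<bar>integral {a..b} (hn n) - integral {a..b} h\<bar> < e/2"
    using LIMSEQ_D[of _ _ "e/2"] e by force
  define k where "k t = h t - hn n t" for t
  have k: "k integrable_on {a..b}" unfolding k_def by (intro integrable_diff hi hn)
  have k0: "k t \<ge> 0" for t by (simp add: k_def hn_def)
  have kI: "integral {a..b} k < e/2"
  proof -
    have "integral {a..b} k = integral {a..b} h - integral {a..b} (hn n)"
      unfolding k_def by (rule integral_diff[OF hi hn])
    then show ?thesis using n by linarith
  qed
  define \<delta> where "\<delta> = e / (2 * (real n + 1))"
  have \<delta>: "\<delta> > 0" "real n * \<delta> < e/2" using e by (auto simp: \<delta>_def field_simps)
  show "\<exists>\<delta>>0. \<forall>P :: (real \<times> real) set. finite P \<and>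
        (\<forall>(u, v) \<in> P. a \<le> u \<and> u \<le> v \<and> v \<le> b) \<and>
        pairwise (\<lambda>(u, v) (u', v'). {u<..<v} \<inter> {u'<..<v'} = {}) P \<and>
        (\<Sum>(u, v)\<in>P. v - u) < \<delta> \<longrightarrow>
        (\<Sum>(u, v)\<in>P. norm (integral {a..v} f - integral {a..u} f)) < e"
  proof (intro exI[of _ \<delta>] conjI allI impI)
    show "\<delta> > 0" by (rule \<delta>)
    fix P :: "(real \<times> real) set"
    assume "finite P \<and> (\<forall>(u, v) \<in> P. a \<le> u \<and> u \<le> v \<and> v \<le> b) \<and>
        pairwise (\<lambda>(u, v) (u', v'). {u<..<v} \<inter> {u'<..<v'} = {}) P \<and> (\<Sum>(u, v)\<in>P. v - u) < \<delta>"
    then have P: "finite P" "\<And>u v. (u,v) \<in> P \<Longrightarrow> a \<le> u \<and> u \<le> v \<and> v \<le> b"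
      and pw: "pairwise (\<lambda>(u, v) (u', v'). {u<..<v} \<inter> {u'<..<v'} = {}) P"
      and len: "(\<Sum>(u, v)\<in>P. v - u) < \<delta>" by auto
    have sub: "g integrable_on {u..v}" if "g integrable_on {a..b}" "(u,v) \<in> P" for g :: "real \<Rightarrow> real" and u v
      using integrable_on_subinterval[OF that(1)] P(2)[OF that(2)] by fastforce
    \<comment> \<open>The open intervals are disjoint by hypothesis, whereas the closed ones may
      share endpoints.\<close>
    have U: "(k has_integral (\<Sum>z\<in>P. integral {fst z<..<snd z} k)) (\<Union>z\<in>P. {fst z<..<snd z})"
      proof (rule has_integral_UN[OF P(1)])
        fix z assume "z \<in> P"
        then have "k integrable_on {fst z..snd z}" using sub[OF k, of "fst z" "snd z"] by simp
        then have "k integrable_on {fst z<..<snd z}" by (simp add: integrable_on_Icc_iff_Ioo)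
        then show "(k has_integral integral {fst z<..<snd z} k) {fst z<..<snd z}" by (rule integrable_integral)
      next
        show "pairwise (\<lambda>i i'. negligible ({fst i<..<snd i} \<inter> {fst i'<..<snd i'})) P"
          by (rule pairwise_mono[OF pw]) (auto simp: split_def simp del: Int_greaterThanLessThan)
      qed
    have "(\<Sum>(u, v)\<in>P. norm (integral {a..v} f - integral {a..u} f)) \<le> (\<Sum>(u, v)\<in>P. integral {u..v} k + real n * (v - u))"
    proof (rule sum_mono, clarify)
      fix u v assume uv: "(u,v) \<in> P"
      note uv' = P(2)[OF uv]
      have fuv: "f integrable_on {u..v}" using integrable_on_subinterval[OF fi] uv' by fastforce
      have "norm (integral {a..v} f - integral {a..u} f) = norm (integral {u..v} f)"
        using integral_difference_real[OF fi] uv' by simp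
      also have "\<dots> \<le> integral {u..v} (\<lambda>t. k t + real n)"
      proof (rule integral_norm_bound_integral[OF fuv])
        show "(\<lambda>t. k t + real n) integrable_on {u..v}"
          by (intro integrable_add sub[OF k uv] integrable_const_ivl)
        show "norm (f x) \<le> k x + real n" for x by (auto simp: k_def hn_def h_def)
      qed
      also have "\<dots> = integral {u..v} k + real n * (v - u)"
        using uv' by (subst integral_add) (auto intro: sub[OF k uv] integrable_const_ivl)
      finally show "norm (integral {a..v} f - integral {a..u} f) \<le> integral {u..v} k + real n * (v - u)" .
    qed
    also have "\<dots> = (\<Sum>(u, v)\<in>P. integral {u..v} k) + real n * (\<Sum>(u, v)\<in>P. v - u)"
      by (simp add: split_def sum.distrib sum_distrib_left)
    also have "(\<Sum>(u, v)\<in>P. integral {u..v} k) = (\<Sum>z\<in>P. integral {fst z<..<snd z} k)"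
      by (simp add: split_def integral_open_interval_real)
    also have "\<dots> = integral (\<Union>z\<in>P. {fst z<..<snd z}) k" (is "_ = integral ?U k")
      using U by (simp add: integral_unique)
    also have "\<dots> \<le> integral {a..b} k"
    proof (rule integral_subset_le[OF _ _ k])
      show "?U \<subseteq> {a..b}" using P(2) by force
      show "k integrable_on ?U"
        using U by blast
      show "\<forall>x\<in>{a..b}. 0 \<le> k x" using k0 by blast
    qed
    finally show "(\<Sum>(u, v)\<in>P. norm (integral {a..v} f - integral {a..u} f)) < e"
      using kI \<delta> len mult_left_mono[of "\<Sum>(u, v)\<in>P. v - u" \<delta> "real n"] by simp
  qed
qed

section \<open>Integrals depending on a parameter\<close>

text \<open>Split at distance \<open>d/2\<close> from \<open>x\<close>. The near part is at most the
  mass of \<open>g\<close> on a short interval, small uniformly in \<open>x\<close> because the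
  indefinite integral is uniformly continuous; the far part carries the factor exp(- \<tau>
  d/2).\<close>

lemma exp_kernel_integral_small:
  fixes g :: "real \<Rightarrow> real"
  assumes g: "g integrable_on {a..b}" and g0: "\<And>t. g t \<ge> 0" and e: "e > 0"
  obtains T where "T > 0"
    "\<And>\<tau> x. \<tau> \<ge> T \<Longrightarrow> x \<in> {a..b} \<Longrightarrow> integral {a..b} (\<lambda>t. exp (- \<tau> * \<bar>x - t\<bar>) * g t) \<le> e"
proof -
  define F where "F x = integral {a..x} g" for x
  have "uniformly_continuous_on {a..b} F"
    unfolding F_def using indefinite_integral_continuous_1[OF g] by (intro compact_uniformly_continuous) auto
  then obtain d where d: "d > 0" "\<And>x y. x \<in> {a..b} \<Longrightarrow> y \<in> {a..b} \<Longrightarrow> dist y x < d \<Longrightarrow> dist (F y) (F x) < e/4"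
    by (rule uniformly_continuous_onE[of _ _ "e/4"]) (use e in auto)
  define G where "G = integral {a..b} g"
  have G: "G \<ge> 0" unfolding G_def by (rule integral_nonneg[OF g]) (use g0 in auto)
  \<comment> \<open>With q = 2 (G + 1) / e + 1 this gives exp(- \<tau> d/2) \<le> 1/q for \<tau>
    \<ge> T, and G/q \<le> e/2.\<close>
  define T where "T = 1 + 2 * ln (2 * (G + 1) / e + 1) / d"
  show ?thesis
  proof (rule that[of "max 1 T"])
    fix \<tau> x assume "max 1 T \<le> \<tau>" and x: "x \<in> {a..b}"
    then have \<tau>: "\<tau> \<ge> T" "\<tau> \<ge> 1" by auto
    define u v where "u = max a (x - d/2)" and "v = min b (x + d/2)"
    have uv: "a \<le> u" "u \<le> x" "x \<le> v" "v \<le> b" using x d by (auto simp: u_def v_def)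
    have sub: "g integrable_on {u..v}" using integrable_on_subinterval[OF g] uv by fastforce
    define h where "h t = (if t \<in> {u..v} then g t else 0) + exp (- \<tau> * (d/2)) * g t" for t
    have i1: "(\<lambda>t. if t \<in> {u..v} then g t else 0) integrable_on {a..b}"
      using sub uv by (subst integrable_restrict_Int) (auto simp: Int_absorb2)
    have h: "h integrable_on {a..b}" unfolding h_def
      by (intro integrable_add i1 integrable_on_mult_right g)
    have le: "exp (- \<tau> * \<bar>x - t\<bar>) * g t \<le> h t" if t: "t \<in> {a..b}" for t
    proof (cases "t \<in> {u..v}")
      case True
      have "exp (- \<tau> * \<bar>x - t\<bar>) * g t \<le> 1 * g t" using \<tau> g0 by (intro mult_right_mono) auto
      then show ?thesis using True g0[of t] by (simp add: h_def add_increasing2)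
    next
      case False
      then have "d/2 \<le> \<bar>x - t\<bar>" using t by (auto simp: u_def v_def abs_if)
      then have "exp (- \<tau> * \<bar>x - t\<bar>) * g t \<le> exp (- \<tau> * (d/2)) * g t" using \<tau> g0
        by (intro mult_right_mono) auto
      then show ?thesis using False by (auto simp: h_def)
    qed
    have "integral {a..b} (\<lambda>t. exp (- \<tau> * \<bar>x - t\<bar>) * g t) \<le> integral {a..b} h"
    proof (rule integral_le[OF _ h le])
      have "g absolutely_integrable_on {a..b}" using g g0 by (intro nonnegative_absolutely_integrable_1) auto
      then have "(\<lambda>t. exp (- \<tau> * \<bar>x - t\<bar>) * g t) absolutely_integrable_on {a..b}"
        by (intro absolutely_integrable_continuous_mult continuous_intros)
      then show "(\<lambda>t. exp (- \<tau> * \<bar>x - t\<bar>) * g t) integrable_on {a..b}"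
        using set_lebesgue_integral_eq_integral(1) by (auto simp: real_scaleR_def)
    qed
    also have "integral {a..b} h = integral {u..v} g + exp (- \<tau> * (d/2)) * G"
    proof -
      have "integral {a..b} (\<lambda>t. if t \<in> {u..v} then g t else 0) = integral {u..v} g"
        using uv by (subst integral_restrict_Int) (auto simp: Int_absorb2)
      moreover have "integral {a..b} h = integral {a..b} (\<lambda>t. if t \<in> {u..v} then g t else 0)
          + integral {a..b} (\<lambda>t. exp (- \<tau> * (d/2)) * g t)"
        unfolding h_def[abs_def] by (rule integral_add[OF i1 integrable_on_mult_right[OF g]])
      ultimately show ?thesis unfolding G_def by simp
    qed
    also have "integral {u..v} g \<le> e/2"
    proof -
      have "dist u x < d" "dist v x < d" using x d by (auto simp: u_def v_def dist_real_def)
      then have "dist (F u) (F x) < e/4" "dist (F v) (F x) < e/4" using d(2) uv x by auto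
      moreover have "integral {u..v} g = F v - F u"
        using integral_difference_real[OF g, of u v] uv by (simp add: F_def)
      ultimately show ?thesis unfolding dist_real_def by linarith
    qed
    also have "exp (- \<tau> * (d/2)) * G \<le> e/2"
    proof -
      define q where "q = 2 * (G + 1) / e + 1"
      have q: "q > 1" using G e by (simp add: q_def)
      have "2 * ln q / d \<le> \<tau>" using \<tau>(1) by (simp add: T_def q_def)
      then have "ln q \<le> \<tau> * (d/2)" using d(1) by (simp add: field_simps)
      then have "exp (- \<tau> * (d/2)) \<le> exp (- ln q)" by simp
      also have "\<dots> = 1 / q" using q by (simp add: exp_minus inverse_eq_divide)
      finally have "exp (- \<tau> * (d/2)) * G \<le> 1 / q * G" using G by (intro mult_right_mono)
      also have "\<dots> \<le> e/2"
      proof -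
        have "e/2 * q = G + 1 + e/2" using e by (simp add: q_def field_simps)
        then have "G \<le> e/2 * q" using e by linarith
        then show ?thesis using q by (simp add: pos_divide_le_eq)
      qed
      finally show ?thesis .
    qed
    finally show "integral {a..b} (\<lambda>t. exp (- \<tau> * \<bar>x - t\<bar>) * g t) \<le> e" by simp
  qed simp
qed

text \<open>Differentiation under the integral sign. The majorant for the difference quotients comes
  from \<open>g\<close> itself: Cauchy's inequality on discs of radius \<open>r/2\<close> bounds the
  derivative by \<open>g t / (r/2)\<close>, and the mean value inequality passes this bound on to
  the quotients.\<close>

lemma holomorphic_on_integral:
  fixes f :: "complex \<Rightarrow> 'a::euclidean_space \<Rightarrow> complex"
  assumes L: "open L"
    and int: "\<And>z. z \<in> L \<Longrightarrow> f z integrable_on A"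
    and hol: "\<And>t. t \<in> A \<Longrightarrow> (\<lambda>z. f z t) holomorphic_on L"
    and bnd: "\<And>z t. z \<in> L \<Longrightarrow> t \<in> A \<Longrightarrow> norm (f z t) \<le> g t"
    and g: "g integrable_on A"
  shows "(\<lambda>z. integral A (f z)) holomorphic_on L"
proof -
  have "(\<lambda>z. integral A (f z)) field_differentiable (at z0)" if z0: "z0 \<in> L" for z0
  proof -
    obtain r where r: "r > 0" "cball z0 r \<subseteq> L" using L z0 open_contains_cball by blast
    define d where "d t = deriv (\<lambda>z. f z t) z0" for t
    have D: "((\<lambda>z. f z t) has_field_derivative deriv (\<lambda>z. f z t) z) (at z)" if "t \<in> A" "z \<in> L" for t z
      using holomorphic_derivI[OF hol[OF that(1)] L that(2)] .
    have B: "norm (deriv (\<lambda>z. f z t) z) \<le> g t / (r/2)" if t: "t \<in> A" and z: "z \<in> ball z0 (r/2)" for t z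
    proof -
      have sub: "cball z (r/2) \<subseteq> L"
      proof
        fix w assume "w \<in> cball z (r/2)"
        then have "dist z0 w \<le> r" using z dist_triangle[of z0 w z] by (simp add: dist_commute)
        then show "w \<in> L" using r by auto
      qed
      have h: "(\<lambda>z. f z t) holomorphic_on cball z (r/2)" using holomorphic_on_subset[OF hol[OF t] sub] .
      have "norm ((deriv ^^ 1) (\<lambda>z. f z t) z) \<le> fact 1 * g t / (r/2) ^ 1"
      proof (rule Cauchy_inequality)
        show "(\<lambda>z. f z t) holomorphic_on ball z (r/2)" using h holomorphic_on_subset ball_subset_cball by blast
        show "continuous_on (cball z (r/2)) (\<lambda>z. f z t)" using h by (rule holomorphic_on_imp_continuous_on)
        show "norm (f x t) \<le> g t" if "norm (z - x) = r/2" for x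
          using bnd[of x t] t sub that by (auto simp: dist_norm)
      qed (use r in auto)
      then show ?thesis by simp
    qed
    have quot: "norm ((f z t - f z0 t) / (z - z0)) \<le> g t / (r/2)" if t: "t \<in> A" and z: "z \<in> ball z0 (r/2)" "z \<noteq> z0" for t z
    proof -
      have "norm (f z t - f z0 t) \<le> g t / (r/2) * norm (z - z0)"
      proof (rule field_differentiable_bound[of "ball z0 (r/2)" "\<lambda>z. f z t" "\<lambda>z. deriv (\<lambda>z. f z t) z"])
        show "((\<lambda>z. f z t) has_field_derivative deriv (\<lambda>z. f z t) w) (at w within ball z0 (r/2))" if "w \<in> ball z0 (r/2)" for w
          by (rule has_field_derivative_at_within[OF D[OF t]]) (use that r in auto)
        show "norm (deriv (\<lambda>z. f z t) w) \<le> g t / (r/2)" if "w \<in> ball z0 (r/2)" for w using B[OF t that] .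
      qed (use z r in auto)
      then show ?thesis using z by (simp add: norm_divide divide_le_eq)
    qed
    have g': "(\<lambda>t. g t / (r/2)) integrable_on A"
      using integrable_on_mult_left[OF g, of "1 / (r/2)"] by simp
    \<comment> \<open>Dominated convergence is a statement about sequences, so the limit of the
      quotient is tested along sequences.\<close>
    have key: "(\<lambda>n. (integral A (f (s n)) - integral A (f z0)) / (s n - z0)) \<longlonglongrightarrow> integral A d"
      if s: "\<And>n. s n \<in> ball z0 (r/2) - {z0}" "s \<longlonglongrightarrow> z0" for s :: "nat \<Rightarrow> complex"
    proof -
      have sL: "s n \<in> L" for n using s(1)[of n] r by auto
      have i: "(\<lambda>t. (f (s n) t - f z0 t) / (s n - z0)) integrable_on A" for n
        using integrable_on_mult_left[OF integrable_diff[OF int[OF sL[of n]] int[OF z0]], of "1 / (s n - z0)"] by simp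
      have "(\<lambda>n. integral A (\<lambda>t. (f (s n) t - f z0 t) / (s n - z0))) \<longlonglongrightarrow> integral A d"
      proof (rule dominated_convergence(2)[OF i g'])
        show "norm ((f (s n) t - f z0 t) / (s n - z0)) \<le> g t / (r/2)" if "t \<in> A" for n t
          using quot[OF that, of "s n"] s(1)[of n] by auto
        show "(\<lambda>n. (f (s n) t - f z0 t) / (s n - z0)) \<longlonglongrightarrow> d t" if t: "t \<in> A" for t
        proof -
          have "((\<lambda>z. (f z t - f z0 t) / (z - z0)) \<longlongrightarrow> d t) (at z0)"
            using D[OF t z0] unfolding has_field_derivative_iff d_def .
          then show ?thesis
            by (rule filterlim_compose[of _ _ "at z0"])
               (use s in \<open>auto simp: filterlim_at intro!: always_eventually\<close>)
        qed
      qed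
      moreover have eq: "integral A (\<lambda>t. (f (s n) t - f z0 t) / (s n - z0)) = (integral A (f (s n)) - integral A (f z0)) / (s n - z0)" for n
        using Henstock_Kurzweil_Integration.integral_mult_left[of A "\<lambda>t. f (s n) t - f z0 t" "1 / (s n - z0)"]
          Henstock_Kurzweil_Integration.integral_diff[OF int[OF sL[of n]] int[OF z0]] by simp
      ultimately show ?thesis unfolding eq by blast
    qed
    have "((\<lambda>z. (integral A (f z) - integral A (f z0)) / (z - z0)) \<longlongrightarrow> integral A d) (at z0 within ball z0 (r/2))"
      unfolding tendsto_at_iff_sequentially comp_def using key by blast
    then have "((\<lambda>z. integral A (f z)) has_field_derivative integral A d) (at z0 within ball z0 (r/2))"
      unfolding has_field_derivative_iff .
    then have "((\<lambda>z. integral A (f z)) has_field_derivative integral A d) (at z0)"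
      using r by (simp add: at_within_open[of z0 "ball z0 (r/2)"])
    then show ?thesis unfolding field_differentiable_def by blast
  qed
  then show ?thesis
    unfolding holomorphic_on_def using field_differentiable_at_within by blast
qed

section \<open>The integral equation\<close>

text \<open>
  The rows \<open>i\<close> with \<open>\<mu> i = 0\<close> are those of the block of the column \<open>l\<close>; the rows with \<open>fw i\<close> are
  integrated forward from 0, the others backward from 1.
\<close>
locale picard_system =
  fixes a :: "'n::finite \<Rightarrow> 'n \<Rightarrow> real \<Rightarrow> complex"
    and \<mu> :: "'n \<Rightarrow> complex"
    and fw :: "'n \<Rightarrow> bool"
    and l :: 'n
    and L :: "complex set"
    and G :: real
  assumes a_int: "\<And>i m. a i m absolutely_integrable_on {0..1}"
    and a_zero: "\<And>i m t. \<mu> i = 0 \<Longrightarrow> \<mu> m = 0 \<Longrightarrow> a i m t = 0"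
    and mu_l: "\<mu> l = 0"
    and open_L: "open L"
    and fw_zero: "\<And>i. \<mu> i = 0 \<Longrightarrow> fw i"
    and fw_sgn: "\<And>lam i. lam \<in> L \<Longrightarrow> fw i \<Longrightarrow> Re (\<mu> i * lam) \<le> 0"
    and bw_sgn: "\<And>lam i. lam \<in> L \<Longrightarrow> \<not> fw i \<Longrightarrow> Re (\<mu> i * lam) \<ge> 0"
    and G_ge: "G \<ge> 1" "integral {0..1} (\<lambda>t. \<Sum>i\<in>UNIV. \<Sum>m\<in>UNIV. norm (a i m t)) \<le> G"
    and small: "\<And>lam i x. lam \<in> L \<Longrightarrow> \<mu> i \<noteq> 0 \<Longrightarrow> x \<in> {0..1} \<Longrightarrow>
      integral {0..1} (\<lambda>t. exp (- \<bar>Re (\<mu> i * lam)\<bar> * \<bar>x - t\<bar>) * (\<Sum>i\<in>UNIV. \<Sum>m\<in>UNIV. norm (a i m t))) \<le> 1 / (16 * G)"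
begin

definition g :: "real \<Rightarrow> real" where
  "g t = (\<Sum>i\<in>UNIV. \<Sum>m\<in>UNIV. norm (a i m t))"

definition H :: "('n \<Rightarrow> real \<Rightarrow> complex) \<Rightarrow> 'n \<Rightarrow> real \<Rightarrow> complex" where
  "H z i t = (\<Sum>m\<in>UNIV. a i m t * z m t)"

definition J :: "complex \<Rightarrow> ('n \<Rightarrow> real \<Rightarrow> complex) \<Rightarrow> 'n \<Rightarrow> real \<Rightarrow> real \<Rightarrow> complex" where
  "J lam z i x t = exp (\<mu> i * lam * (of_real x - of_real t)) * H z i t"

text \<open>Both branches are particular solutions of v' = \<mu> v lam + H with \<mu> =
  \<open>\<mu> i\<close> and H = \<open>H z i\<close>, and they differ by a multiple of exp(\<mu>
  lam x). The choice of base point only serves to keep the kernel bounded.\<close>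

definition K :: "complex \<Rightarrow> ('n \<Rightarrow> real \<Rightarrow> complex) \<Rightarrow> 'n \<Rightarrow> real \<Rightarrow> complex" where
  "K lam z i x = (if fw i then integral {0..x} (J lam z i x) else - integral {x..1} (J lam z i x))"

definition kd :: "'n \<Rightarrow> complex" where "kd i = (if i = l then 1 else 0)"

section \<open>Integrability, bounds and regularity of the integral operator\<close>

lemma g_nonneg: "g t \<ge> 0"
  by (auto simp: g_def intro!: sum_nonneg)

lemma g_absolutely_integrable: "g absolutely_integrable_on {0..1}"
  unfolding g_def[abs_def]
  by (intro absolutely_integrable_sum absolutely_integrable_norm[unfolded o_def] a_int) auto

lemma g_integrable: "g integrable_on {0..1}"
  using g_absolutely_integrable set_lebesgue_integral_eq_integral(1) by blast

text \<open>This is where the vanishing diagonal block pays off: in a row with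
  \<open>\<mu> i = 0\<close> the bound \<open>s\<close> is demanded only of the components outside
  the block, as \<open>a_zero\<close> removes the others.\<close>

lemma norm_H_le:
  assumes "\<And>m. \<mu> i \<noteq> 0 \<or> \<mu> m \<noteq> 0 \<Longrightarrow> norm (z m t) \<le> s" "s \<ge> 0"
  shows "norm (H z i t) \<le> s * g t"
proof -
  have "norm (H z i t) \<le> (\<Sum>m\<in>UNIV. s * norm (a i m t))"
    unfolding H_def
  proof (rule sum_norm_le)
    fix m
    show "norm (a i m t * z m t) \<le> s * norm (a i m t)"
      using assms a_zero[of i m t] by (cases "\<mu> i \<noteq> 0 \<or> \<mu> m \<noteq> 0") (auto simp: norm_mult mult.commute intro: mult_right_mono)
  qed
  also have "\<dots> = s * (\<Sum>m\<in>UNIV. norm (a i m t))" by (simp add: sum_distrib_left)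
  also have "\<dots> \<le> s * g t"
    unfolding g_def using assms(2)
    by (intro mult_left_mono member_le_sum[of i UNIV "\<lambda>i. \<Sum>m\<in>UNIV. norm (a i m t)"]) (auto intro: sum_nonneg)
  finally show ?thesis .
qed

lemma H_absolutely_integrable:
  assumes "\<And>m. continuous_on {0..1} (z m)"
  shows "H z i absolutely_integrable_on {0..1}"
proof -
  have "(\<lambda>t. \<Sum>m\<in>UNIV. z m t * a i m t) absolutely_integrable_on {0..1}"
    by (intro absolutely_integrable_sum absolutely_integrable_continuous_mult assms a_int) auto
  then show ?thesis by (simp add: H_def[abs_def] mult.commute)
qed

lemma J_absolutely_integrable:
  assumes "\<And>m. continuous_on {0..1} (z m)"
  shows "J lam z i x absolutely_integrable_on {0..1}"
  unfolding J_def[abs_def]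
  by (intro absolutely_integrable_continuous_mult continuous_intros H_absolutely_integrable assms)

lemma J_integrable:
  assumes "\<And>m. continuous_on {0..1} (z m)" "0 \<le> u" "v \<le> 1"
  shows "J lam z i x integrable_on {u..v}"
proof (rule integrable_on_subinterval)
  show "J lam z i x integrable_on {0..1}"
    by (rule set_lebesgue_integral_eq_integral(1)[OF J_absolutely_integrable[OF assms(1)]])
qed (use assms in auto)

lemma K_diff:
  assumes z: "\<And>m. continuous_on {0..1} (z m)" and w: "\<And>m. continuous_on {0..1} (w m)" and x: "x \<in> {0..1}"
  shows "K lam (\<lambda>m t. z m t - w m t) i x = K lam z i x - K lam w i x"
proof -
  have "J lam (\<lambda>m t. z m t - w m t) i x = (\<lambda>t. J lam z i x t - J lam w i x t)"
    by (simp add: J_def H_def fun_eq_iff right_diff_distrib sum_subtractf)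
  then show ?thesis
    unfolding K_def using x by (simp add: integral_diff J_integrable z w)
qed

text \<open>The direction of integration matches the sign of Re (\<mu> lam), so on the side that is
  integrated the exponent always has nonpositive real part.\<close>

lemma norm_J_le:
  assumes lam: "lam \<in> L" and b: "norm (H z i t) \<le> s * g t"
    and t: "if fw i then t \<le> x else x \<le> t"
  shows "norm (J lam z i x t) \<le> s * (exp (- \<bar>Re (\<mu> i * lam)\<bar> * \<bar>x - t\<bar>) * g t)"
proof -
  have "Re (\<mu> i * lam * (of_real x - of_real t)) = Re (\<mu> i * lam * of_real (x - t))" by simp
  also have "\<dots> = Re (\<mu> i * lam) * (x - t)" by (simp only: Re_complex_of_real Im_complex_of_real times_complex.sel)
  also have "\<dots> = - \<bar>Re (\<mu> i * lam)\<bar> * \<bar>x - t\<bar>"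
  proof (cases "fw i")
    case True
    have "\<bar>Re (\<mu> i * lam)\<bar> = - Re (\<mu> i * lam)" "\<bar>x - t\<bar> = x - t"
      using abs_of_nonpos[OF fw_sgn[OF lam True]] t True by auto
    then show ?thesis by (simp only: minus_minus)
  next
    case False
    have "\<bar>Re (\<mu> i * lam)\<bar> = Re (\<mu> i * lam)" "\<bar>x - t\<bar> = - (x - t)"
      using abs_of_nonneg[OF bw_sgn[OF lam False]] t False by auto
    then show ?thesis by (simp only: minus_mult_minus)
  qed
  finally have "norm (exp (\<mu> i * lam * (of_real x - of_real t))) = exp (- \<bar>Re (\<mu> i * lam)\<bar> * \<bar>x - t\<bar>)"
    by (simp add: norm_exp_eq_Re)
  then have "norm (J lam z i x t) = exp (- \<bar>Re (\<mu> i * lam)\<bar> * \<bar>x - t\<bar>) * norm (H z i t)"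
    by (simp add: J_def norm_mult)
  also have "\<dots> \<le> exp (- \<bar>Re (\<mu> i * lam)\<bar> * \<bar>x - t\<bar>) * (s * g t)"
    using b by (intro mult_left_mono) auto
  finally show ?thesis by (simp add: mult_ac)
qed

lemma norm_K_le:
  assumes lam: "lam \<in> L" and z: "\<And>m. continuous_on {0..1} (z m)" and x: "x \<in> {0..1}"
    and b: "\<And>t. t \<in> {0..1} \<Longrightarrow> norm (H z i t) \<le> s * g t" and s: "s \<ge> 0"
  shows "norm (K lam z i x) \<le> s * integral {0..1} (\<lambda>t. exp (- \<bar>Re (\<mu> i * lam)\<bar> * \<bar>x - t\<bar>) * g t)"
proof -
  define h where "h t = exp (- \<bar>Re (\<mu> i * lam)\<bar> * \<bar>x - t\<bar>) * g t" for t
  have h: "h integrable_on {0..1}"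
    unfolding h_def[abs_def]
    by (intro set_lebesgue_integral_eq_integral(1) absolutely_integrable_continuous_mult continuous_intros g_absolutely_integrable)
  have h0: "h t \<ge> 0" for t by (simp add: h_def g_nonneg)
  define A where "A = (if fw i then {0..x} else {x..1})"
  have A: "A \<subseteq> {0..1}" using x by (auto simp: A_def)
  have hA: "h integrable_on A" unfolding A_def using integrable_on_subinterval[OF h] x by auto
  have "norm (K lam z i x) = norm (integral A (J lam z i x))" by (simp add: K_def A_def)
  also have "\<dots> \<le> integral A (\<lambda>t. s * h t)"
  proof (rule integral_norm_bound_integral)
    show "J lam z i x integrable_on A" unfolding A_def using x J_integrable[OF z] by auto
    show "(\<lambda>t. s * h t) integrable_on A" by (rule integrable_on_mult_right[OF hA])
    show "norm (J lam z i x t) \<le> s * h t" if "t \<in> A" for t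
      unfolding h_def using norm_J_le[OF lam b, of t x] A that by (auto simp: A_def split: if_splits)
  qed
  also have "\<dots> = s * integral A h" by simp
  also have "\<dots> \<le> s * integral {0..1} h"
    using integral_subset_le[OF A hA h] h0 s by (intro mult_left_mono) auto
  finally show ?thesis unfolding h_def .
qed

text \<open>The kernel is 1 here and offers no decay. The gain is that \<open>s\<close> need not
  dominate the components inside the block, which may be much larger.\<close>

lemma norm_K_le_diagonal:
  assumes "lam \<in> L" "\<And>m. continuous_on {0..1} (z m)" "x \<in> {0..1}"
    and b: "\<And>m t. \<mu> m \<noteq> 0 \<Longrightarrow> t \<in> {0..1} \<Longrightarrow> norm (z m t) \<le> s" and s: "s \<ge> 0" and i: "\<mu> i = 0"
  shows "norm (K lam z i x) \<le> s * G"
proof -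
  have "norm (K lam z i x) \<le> s * integral {0..1} (\<lambda>t. exp (- \<bar>Re (\<mu> i * lam)\<bar> * \<bar>x - t\<bar>) * g t)"
    by (rule norm_K_le[OF assms(1-3)]) (use b s i norm_H_le in auto)
  also have "\<dots> \<le> s * G" using G_ge(2) s i by (intro mult_left_mono) (auto simp: g_def)
  finally show ?thesis .
qed

text \<open>Here \<open>s\<close> must bound all components; the small factor comes from the
  decaying kernel.\<close>

lemma norm_K_le_offdiagonal:
  assumes "lam \<in> L" "\<And>m. continuous_on {0..1} (z m)" "x \<in> {0..1}"
    and b: "\<And>m t. t \<in> {0..1} \<Longrightarrow> norm (z m t) \<le> s" and s: "s \<ge> 0"
    and e: "integral {0..1} (\<lambda>t. exp (- \<bar>Re (\<mu> i * lam)\<bar> * \<bar>x - t\<bar>) * g t) \<le> e"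
  shows "norm (K lam z i x) \<le> s * e"
proof -
  have "norm (K lam z i x) \<le> s * integral {0..1} (\<lambda>t. exp (- \<bar>Re (\<mu> i * lam)\<bar> * \<bar>x - t\<bar>) * g t)"
    by (rule norm_K_le[OF assms(1-3)]) (use b s norm_H_le in auto)
  also have "\<dots> \<le> s * e" using e s by (intro mult_left_mono) auto
  finally show ?thesis .
qed

text \<open>Pulling exp(\<mu> lam x) out of the kernel leaves an integrand free of \<open>x\<close>.
  A backward integral is then a forward one minus the integral over the whole interval, so both
  directions share one form that can be differentiated; \<open>C\<close> records the
  direction.\<close>

lemma K_eq_indefinite:
  assumes z: "\<And>m. continuous_on {0..1} (z m)"
  obtains C where "\<And>x. x \<in> {0..1} \<Longrightarrow>
    K lam z i x = exp (\<mu> i * lam * of_real x) * (C + integral {0..x} (\<lambda>t. exp (- (\<mu> i * lam * of_real t)) * H z i t))"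
proof -
  define h where "h t = exp (- (\<mu> i * lam * of_real t)) * H z i t" for t
  have h: "h integrable_on {0..1}"
    unfolding h_def[abs_def]
    by (intro set_lebesgue_integral_eq_integral(1) absolutely_integrable_continuous_mult continuous_intros H_absolutely_integrable z)
  have J: "J lam z i x = (\<lambda>t. exp (\<mu> i * lam * of_real x) * h t)" for x
    by (simp add: J_def h_def fun_eq_iff right_diff_distrib exp_diff exp_minus divide_inverse)
  have split: "integral {x..1} h = integral {0..1} h - integral {0..x} h" if "x \<in> {0..1}" for x
    using Henstock_Kurzweil_Integration.integral_combine[of 0 x 1 h] h that by (simp add: algebra_simps)
  show ?thesis
  proof (rule that[of "if fw i then 0 else - integral {0..1} h"])
    show "K lam z i x = exp (\<mu> i * lam * of_real x) * ((if fw i then 0 else - integral {0..1} h) +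
       integral {0..x} (\<lambda>t. exp (- (\<mu> i * lam * of_real t)) * H z i t))" if "x \<in> {0..1}" for x
      unfolding K_def J h_def[symmetric] by (simp add: split[OF that] algebra_simps)
  qed
qed

lemma K_continuous:
  assumes z: "\<And>m. continuous_on {0..1} (z m)"
  shows "continuous_on {0..1} (K lam z i)"
proof -
  obtain C where C: "\<And>x. x \<in> {0..1} \<Longrightarrow>
    K lam z i x = exp (\<mu> i * lam * of_real x) * (C + integral {0..x} (\<lambda>t. exp (- (\<mu> i * lam * of_real t)) * H z i t))"
    by (rule K_eq_indefinite[where z = z and lam = lam and i = i, OF z]) blast
  have "(\<lambda>t. exp (- (\<mu> i * lam * of_real t)) * H z i t) integrable_on {0..1}"
    by (intro set_lebesgue_integral_eq_integral(1) absolutely_integrable_continuous_mult continuous_intros H_absolutely_integrable z)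
  then have "continuous_on {0..1} (\<lambda>x. exp (\<mu> i * lam * of_real x) * (C + integral {0..x} (\<lambda>t. exp (- (\<mu> i * lam * of_real t)) * H z i t)))"
    by (intro continuous_intros indefinite_integral_continuous_1)
  then show ?thesis by (rule continuous_on_eq) (simp add: C)
qed

lemma K_holomorphic:
  assumes z: "\<And>lam m. lam \<in> L \<Longrightarrow> continuous_on {0..1} (z lam m)"
    and hol: "\<And>m t. t \<in> {0..1} \<Longrightarrow> (\<lambda>lam. z lam m t) holomorphic_on L"
    and bnd: "\<And>lam m t. lam \<in> L \<Longrightarrow> t \<in> {0..1} \<Longrightarrow> norm (z lam m t) \<le> M"
    and x: "x \<in> {0..1}"
  shows "(\<lambda>lam. K lam (z lam) i x) holomorphic_on L"
proof (cases "L = {}")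
  case False
  then obtain lam0 where "lam0 \<in> L" by blast
  then have "norm (z lam0 i 0) \<le> M" using bnd by simp
  then have M: "M \<ge> 0" by (rule order_trans[OF norm_ge_zero])
  have hJ: "(\<lambda>lam. J lam (z lam) i x t) holomorphic_on L" if "t \<in> {0..1}" for t
    unfolding J_def H_def by (intro holomorphic_intros hol that)
  \<comment> \<open>A majorant independent of \<open>lam\<close>, as differentiation under the
    integral requires.\<close>
  have b: "norm (J lam (z lam) i x t) \<le> M * g t"
    if "lam \<in> L" "t \<in> {0..1}" "if fw i then t \<le> x else x \<le> t" for lam t
  proof -
    have "norm (J lam (z lam) i x t) \<le> M * (exp (- \<bar>Re (\<mu> i * lam)\<bar> * \<bar>x - t\<bar>) * g t)"
      by (rule norm_J_le[OF that(1) norm_H_le that(3)]) (use bnd that M in auto)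
    also have "\<dots> \<le> M * (1 * g t)"
      by (intro mult_left_mono mult_right_mono g_nonneg M) auto
    finally show ?thesis by simp
  qed
  have gM: "(\<lambda>t. M * g t) integrable_on {u..v}" if "0 \<le> u" "v \<le> 1" for u v
    using integrable_on_subinterval[OF integrable_on_mult_right[OF g_integrable, of M], of u v] that by auto
  have 1: "(\<lambda>lam. integral {0..x} (J lam (z lam) i x)) holomorphic_on L" if "fw i"
    by (rule holomorphic_on_integral[OF open_L, where g = "\<lambda>t. M * g t"])
       (use that x b gM hJ J_integrable[OF z] in auto)
  have 2: "(\<lambda>lam. - integral {x..1} (J lam (z lam) i x)) holomorphic_on L" if "\<not> fw i"
    by (rule holomorphic_on_minus, rule holomorphic_on_integral[OF open_L, where g = "\<lambda>t. M * g t"])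
       (use that x b gM hJ J_integrable[OF z] in auto)
  show ?thesis unfolding K_def using 1 2 by (cases "fw i") auto
qed (simp add: holomorphic_on_def)

section \<open>The Neumann series and its geometric convergence\<close>

fun Z :: "nat \<Rightarrow> complex \<Rightarrow> 'n \<Rightarrow> real \<Rightarrow> complex" where
  "Z 0 lam = (\<lambda>i x. 0)"
| "Z (Suc n) lam = (\<lambda>i x. kd i + K lam (Z n lam) i x)"

lemma Z_continuous: "continuous_on {0..1} (Z n lam i)"
proof (induction n arbitrary: i)
  case (Suc n)
  show ?case by (simp add: continuous_intros K_continuous[OF Suc])
qed simp

text \<open>The weights that make \<open>K\<close> a contraction with factor 1/2.\<close>
definition w :: "'n \<Rightarrow> real" where "w i = (if \<mu> i = 0 then 1 else 1 / (4 * G))"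

lemma w_bounds: "0 \<le> w i" "w i \<le> 1"
  using G_ge(1) by (auto simp: w_def)

text \<open>In the norm sup |z_i| / \<open>w i\<close> the operator shrinks by 1/4. A row of the
  block sees only components of weight 1/(4 G), against mass \<open>G\<close>; any other row sees
  components of weight up to 1, against 1/(16 G), a quarter of its own weight. The ratio 1/2 is a
  convenient weakening.\<close>

lemma Z_diff_bound:
  assumes lam: "lam \<in> L" and x: "x \<in> {0..1}"
  shows "norm (Z (Suc n) lam i x - Z n lam i x) \<le> w i * (1/2) ^ n"
  using x
proof (induction n arbitrary: i x)
  case 0
  \<comment> \<open>Starting the iteration at 0 makes the first difference the unit vector
    \<open>kd\<close>, of weighted size 1 since \<open>w l = 1\<close>.\<close>
  have "K lam (\<lambda>i x. 0) i x = 0" by (simp add: K_def J_def[abs_def] H_def)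
  then show ?case using mu_l G_ge(1) by (simp add: kd_def w_def)
next
  case (Suc n)
  define d where "d m t = Z (Suc n) lam m t - Z n lam m t" for m t
  have cd: "continuous_on {0..1} (d m)" for m
    unfolding d_def by (intro continuous_intros Z_continuous)
  have eq: "Z (Suc (Suc n)) lam i x - Z (Suc n) lam i x = K lam d i x"
    unfolding d_def by (subst K_diff[OF Z_continuous Z_continuous Suc.prems]) simp
  have d: "norm (d m t) \<le> w m * (1/2)^n" if "t \<in> {0..1}" for m t
    unfolding d_def by (rule Suc.IH[OF that])
  have d1: "norm (d m t) \<le> (1/2)^n" if "t \<in> {0..1}" for m t
  proof -
    have "w m * (1/2)^n \<le> 1 * (1/2)^n" by (intro mult_right_mono w_bounds) auto
    then show ?thesis using order_trans[OF d[OF that, of m]] by simp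
  qed
  show ?case
  proof (cases "\<mu> i = 0")
    case True
    have "norm (K lam d i x) \<le> (1 / (4 * G) * (1/2)^n) * G"
    proof (rule norm_K_le_diagonal[OF lam cd Suc.prems _ _ True])
      show "norm (d m t) \<le> 1 / (4 * G) * (1 / 2) ^ n" if "\<mu> m \<noteq> 0" "t \<in> {0..1}" for m t
        using d[OF that(2), of m] that(1) by (simp add: w_def)
    qed (use G_ge in auto)
    also have "\<dots> = (1/2)^n / 4" using G_ge(1) by (simp add: field_simps)
    also have "\<dots> \<le> w i * (1/2)^Suc n" using True by (simp add: w_def)
    finally show ?thesis unfolding eq .
  next
    case False
    have "norm (K lam d i x) \<le> (1/2)^n * (1 / (16 * G))"
      by (rule norm_K_le_offdiagonal[OF lam cd Suc.prems d1])
         (use small[OF lam False Suc.prems] in \<open>auto simp: g_def\<close>)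
    also have "\<dots> \<le> w i * (1/2)^Suc n" using False G_ge(1) by (simp add: w_def field_simps)
    finally show ?thesis unfolding eq .
  qed
qed

lemma Z_eq_sum: "Z n lam i x = (\<Sum>j<n. Z (Suc j) lam i x - Z j lam i x)"
  using sum_lessThan_telescope[of "\<lambda>j. Z j lam i x" n] by (simp del: Z.simps(2))

lemma Z_bound:
  assumes "lam \<in> L" "x \<in> {0..1}"
  shows "norm (Z n lam i x) \<le> 2 * w i"
proof -
  have "norm (Z n lam i x) \<le> (\<Sum>j<n. w i * (1/2)^j)"
    unfolding Z_eq_sum[of n] by (rule sum_norm_le) (rule Z_diff_bound[OF assms])
  also have "\<dots> = w i * (2 - 2 * (1/2)^n)"
    by (subst sum_distrib_left[symmetric], subst geometric_sum) auto
  also have "\<dots> \<le> w i * 2" by (intro mult_left_mono w_bounds) auto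
  finally show ?thesis by simp
qed

lemma Z_holomorphic:
  assumes "x \<in> {0..1}" shows "(\<lambda>lam. Z n lam i x) holomorphic_on L"
  using assms
proof (induction n arbitrary: i x)
  case (Suc n)
  have "(\<lambda>lam. K lam (Z n lam) i x) holomorphic_on L"
  proof (rule K_holomorphic[OF Z_continuous Suc.IH])
    show "norm (Z n lam m t) \<le> 2" if "lam \<in> L" "t \<in> {0..1}" for lam m t
      using Z_bound[OF that, of n m] w_bounds[of m] by simp
  qed (use Suc.prems in auto)
  then show ?case by (simp add: holomorphic_intros)
qed simp

section \<open>The limit of the series: regularity, integral equation and asymptotics\<close>

definition W :: "complex \<Rightarrow> 'n \<Rightarrow> real \<Rightarrow> complex" where
  "W lam i x = (\<Sum>j. Z (Suc j) lam i x - Z j lam i x)"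

text \<open>One M-test on the product set serves both variables: its slices give continuity in
  \<open>x\<close> and holomorphy in \<open>lam\<close>.\<close>

lemma W_limit: "uniform_limit (L \<times> {0..1}) (\<lambda>n p. Z n (fst p) i (snd p)) (\<lambda>p. W (fst p) i (snd p)) sequentially"
proof -
  have "uniform_limit (L \<times> {0..1}) (\<lambda>n p. \<Sum>j<n. Z (Suc j) (fst p) i (snd p) - Z j (fst p) i (snd p))
     (\<lambda>p. \<Sum>j. Z (Suc j) (fst p) i (snd p) - Z j (fst p) i (snd p)) sequentially"
  proof (rule Weierstrass_m_test)
    show "norm (Z (Suc n) (fst p) i (snd p) - Z n (fst p) i (snd p)) \<le> w i * (1/2)^n" if "p \<in> L \<times> {0..1}" for n p
      using Z_diff_bound that by auto
    show "summable (\<lambda>n. w i * (1/2)^n)" by (intro summable_mult summable_geometric) auto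
  qed
  then show ?thesis unfolding W_def Z_eq_sum[symmetric] .
qed

lemma W_limit_x:
  assumes "lam \<in> L" shows "uniform_limit {0..1} (\<lambda>n. Z n lam i) (W lam i) sequentially"
  using uniform_limit_compose'[OF W_limit, of "\<lambda>x. (lam, x)" "{0..1}" i] assms by auto

lemma W_limit_lam:
  assumes "x \<in> {0..1}" shows "uniform_limit L (\<lambda>n lam. Z n lam i x) (\<lambda>lam. W lam i x) sequentially"
  using uniform_limit_compose'[OF W_limit, of "\<lambda>lam. (lam, x)" L i] assms by auto

lemma W_continuous: assumes "lam \<in> L" shows "continuous_on {0..1} (W lam i)"
  by (rule uniform_limit_theorem[OF _ W_limit_x[OF assms]]) (auto simp: Z_continuous)

lemma W_holomorphic: assumes "x \<in> {0..1}" shows "(\<lambda>lam. W lam i x) holomorphic_on L"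
proof (rule holomorphic_uniform_sequence[OF open_L Z_holomorphic[OF assms]])
  fix lam assume "lam \<in> L"
  then obtain d where "d > 0" "cball lam d \<subseteq> L" using open_L open_contains_cball by blast
  then show "\<exists>d>0. cball lam d \<subseteq> L \<and> uniform_limit (cball lam d) (\<lambda>n lam. Z n lam i x) (\<lambda>lam. W lam i x) sequentially"
    using uniform_limit_on_subset[OF W_limit_lam[OF assms]] by blast
qed

lemma W_bound:
  assumes "lam \<in> L" "x \<in> {0..1}"
  shows "norm (W lam i x) \<le> 2 * w i"
proof (rule Lim_norm_ubound)
  show "((\<lambda>n. Z n lam i x) \<longlongrightarrow> W lam i x) sequentially"
    by (rule tendsto_uniform_limitI[OF W_limit_x[OF assms(1)] assms(2)])
qed (use Z_bound[OF assms] in auto)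

lemma W_fixed_point:
  assumes lam: "lam \<in> L" and x: "x \<in> {0..1}"
  shows "W lam i x = kd i + K lam (W lam) i x"
proof (rule LIMSEQ_unique)
  show "(\<lambda>n. Z (Suc n) lam i x) \<longlonglongrightarrow> W lam i x"
    by (rule LIMSEQ_Suc, rule tendsto_uniform_limitI[OF W_limit_x[OF lam] x])
  have "(\<lambda>n. K lam (Z n lam) i x) \<longlonglongrightarrow> K lam (W lam) i x"
  proof (rule LIMSEQ_I)
    fix e :: real assume e: "e > 0"
    \<comment> \<open>In the unweighted sup norm \<open>K\<close> is bounded by \<open>G\<close>:
      rows of the block by total mass, the others by 1/(16 G) \<le> G. This suffices for passing to
      the limit in the recursion.\<close>
    define s where "s = e / (2 * G)"
    have s: "s > 0" "s * G < e" using e G_ge(1) by (auto simp: s_def)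
    have "\<forall>\<^sub>F n in sequentially. \<forall>t\<in>{0..1}. dist (Z n lam m t) (W lam m t) < s" for m
      using uniform_limitD[OF W_limit_x[OF lam, of m] s(1)] .
    then have "\<forall>\<^sub>F n in sequentially. \<forall>m. \<forall>t\<in>{0..1}. dist (Z n lam m t) (W lam m t) < s"
      by (simp add: eventually_all_finite)
    then obtain N where N: "\<And>n m t. n \<ge> N \<Longrightarrow> t \<in> {0..1} \<Longrightarrow> dist (Z n lam m t) (W lam m t) < s"
      unfolding eventually_sequentially by blast
    have "norm (K lam (Z n lam) i x - K lam (W lam) i x) < e" if n: "n \<ge> N" for n
    proof -
      define d where "d m t = Z n lam m t - W lam m t" for m t
      have cd: "continuous_on {0..1} (d m)" for m
        unfolding d_def by (intro continuous_intros Z_continuous W_continuous lam)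
      have b: "norm (d m t) \<le> s" if "t \<in> {0..1}" for m t
        using N[OF n that, of m] by (simp add: d_def dist_norm)
      have "norm (K lam d i x) \<le> s * G"
      proof (cases "\<mu> i = 0")
        case True
        then show ?thesis using norm_K_le_diagonal[OF lam cd x b] s by auto
      next
        case False
        have "norm (K lam d i x) \<le> s * (1 / (16 * G))"
          by (rule norm_K_le_offdiagonal[OF lam cd x b]) (use small[OF lam False x] s in \<open>auto simp: g_def\<close>)
        also have "s * (1 / (16 * G)) \<le> s * G"
        proof (rule mult_left_mono)
          have "1 / (16 * G) \<le> 1" using G_ge(1) by simp
          then show "1 / (16 * G) \<le> G" using G_ge(1) by linarith
        qed (use s in auto)
        finally show ?thesis .
      qed
      moreover have "K lam d i x = K lam (Z n lam) i x - K lam (W lam) i x"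
        unfolding d_def by (rule K_diff[OF Z_continuous W_continuous[OF lam] x])
      ultimately show ?thesis using s(2) by simp
    qed
    then show "\<exists>N. \<forall>n\<ge>N. norm (K lam (Z n lam) i x - K lam (W lam) i x) < e" by blast
  qed
  then show "(\<lambda>n. Z (Suc n) lam i x) \<longlonglongrightarrow> kd i + K lam (W lam) i x"
    by (simp add: tendsto_intros)
qed

text \<open>A two-stage bootstrap. Since \<open>W\<close> is bounded by 2, the rows outside the
  block are at most 2 e, and there \<open>kd\<close> vanishes, so these are the components of
  \<open>W\<close> themselves. Fed into the rows of the block they produce at most 2 e G.\<close>

lemma W_asymptotics:
  assumes lam: "lam \<in> L" and x: "x \<in> {0..1}"
    and e: "\<And>i x. \<mu> i \<noteq> 0 \<Longrightarrow> x \<in> {0..1} \<Longrightarrow>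
      integral {0..1} (\<lambda>t. exp (- \<bar>Re (\<mu> i * lam)\<bar> * \<bar>x - t\<bar>) * (\<Sum>i\<in>UNIV. \<Sum>m\<in>UNIV. norm (a i m t))) \<le> e"
    and e0: "e \<ge> 0"
  shows "norm (W lam i x - kd i) \<le> 2 * G * e"
proof -
  have b: "norm (W lam m t) \<le> 2" if "t \<in> {0..1}" for m t
    using W_bound[OF lam that, of m] w_bounds[of m] by simp
  have K: "W lam m t - kd m = K lam (W lam) m t" if "t \<in> {0..1}" for m t
    using W_fixed_point[OF lam that, of m] by simp
  have off: "norm (K lam (W lam) m t) \<le> 2 * e" if "t \<in> {0..1}" "\<mu> m \<noteq> 0" for m t
    by (rule norm_K_le_offdiagonal[OF lam W_continuous[OF lam] that(1) b]) (use e that in \<open>auto simp: g_def\<close>)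
  show ?thesis
  proof (cases "\<mu> i = 0")
    case True
    have "norm (K lam (W lam) i x) \<le> (2 * e) * G"
    proof (rule norm_K_le_diagonal[OF lam W_continuous[OF lam] x _ _ True])
      show "norm (W lam m t) \<le> 2 * e" if "\<mu> m \<noteq> 0" "t \<in> {0..1}" for m t
      proof -
        have "kd m = 0" using that(1) mu_l by (auto simp: kd_def)
        then show ?thesis using off[OF that(2,1)] K[OF that(2), of m] by simp
      qed
    qed (use e0 in auto)
    then show ?thesis using K[OF x] by (simp add: mult_ac)
  next
    case False
    have "2 * e \<le> 2 * G * e" using e0 G_ge(1) mult_right_mono[of 1 G "2*e"] by simp
    then show ?thesis using off[OF x False] K[OF x] by simp
  qed
qed

lemma W_eq_indefinite:
  assumes lam: "lam \<in> L"
  obtains C where "\<And>x. x \<in> {0..1} \<Longrightarrow> W lam i x = exp (\<mu> i * lam * of_real x) *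
    (C + integral {0..x} (\<lambda>t. exp (- (\<mu> i * lam * of_real t)) * (\<Sum>m\<in>UNIV. a i m t * W lam m t)))"
proof -
  obtain C where C: "\<And>x. x \<in> {0..1} \<Longrightarrow> K lam (W lam) i x = exp (\<mu> i * lam * of_real x) *
      (C + integral {0..x} (\<lambda>t. exp (- (\<mu> i * lam * of_real t)) * H (W lam) i t))"
    by (rule K_eq_indefinite[where z = "W lam" and lam = lam and i = i, OF W_continuous[OF lam]]) blast
  show ?thesis
  proof (rule that[of "kd i + C"])
    fix x :: real assume x: "x \<in> {0..1}"
    \<comment> \<open>The only nonzero entry of \<open>kd\<close> sits at \<open>l\<close>, where
      the exponent vanishes; hence it can be absorbed into the constant.\<close>
    have "kd i = exp (\<mu> i * lam * of_real x) * kd i" using mu_l by (simp add: kd_def)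
    then show "W lam i x = exp (\<mu> i * lam * of_real x) *
      (kd i + C + integral {0..x} (\<lambda>t. exp (- (\<mu> i * lam * of_real t)) * (\<Sum>m\<in>UNIV. a i m t * W lam m t)))"
      using W_fixed_point[OF lam x, of i] C[OF x] unfolding H_def by (simp add: distrib_left)
  qed
qed

end

section \<open>Gronwall's lemma and closure properties of absolute continuity\<close>

text \<open>Induction over steps short enough for the integral of \<open>n\<close> over each to be less than 1/2.\<close>
lemma gronwall_zero:
  fixes f n :: "real \<Rightarrow> real"
  assumes f: "continuous_on {a..b} f" and f0: "\<And>x. x \<in> {a..b} \<Longrightarrow> f x \<ge> 0"
    and n: "n absolutely_integrable_on {a..b}" and n0: "\<And>x. n x \<ge> 0"
    and le: "\<And>x. x \<in> {a..b} \<Longrightarrow> f x \<le> integral {a..x} (\<lambda>t. f t * n t)"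
    and x: "x \<in> {a..b}"
  shows "f x = 0"
proof -
  have ni: "n integrable_on {a..b}" using n set_lebesgue_integral_eq_integral(1) by blast
  have nfi: "(\<lambda>t. f t * n t) integrable_on {a..b}"
    by (rule set_lebesgue_integral_eq_integral(1)[OF absolutely_integrable_continuous_mult[OF f n]])
  have "uniformly_continuous_on {a..b} (\<lambda>x. integral {a..x} n)"
    using indefinite_integral_continuous_1[OF ni] by (intro compact_uniformly_continuous) auto
  then obtain d where d: "d > 0" "\<And>x y. x \<in> {a..b} \<Longrightarrow> y \<in> {a..b} \<Longrightarrow> dist y x < d \<Longrightarrow>
      dist (integral {a..y} n) (integral {a..x} n) < 1/2"
    by (rule uniformly_continuous_onE[of _ _ "1/2"]) auto
  have P: "\<forall>x\<in>{a..b}. x \<le> a + real j * (d/2) \<longrightarrow> f x = 0" for j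
  proof (induction j)
    case 0
    show ?case
    proof (intro ballI impI)
      fix x assume x: "x \<in> {a..b}" "x \<le> a + real 0 * (d/2)"
      then have "x = a" by auto
      then show "f x = 0" using le[OF x(1)] f0[OF x(1)] by simp
    qed
  next
    case (Suc j)
    define v where "v = a + real j * (d/2)"
    have va: "a \<le> v" using d(1) by (simp add: v_def)
    have Sv: "a + real (Suc j) * (d/2) = v + d/2" by (simp add: v_def algebra_simps add_divide_distrib)
    have IH: "f x = 0" if "x \<in> {a..b}" "x \<le> v" for x using Suc that by (simp add: v_def)
    show ?case unfolding Sv
    proof (intro ballI impI)
      fix x assume x: "x \<in> {a..b}" "x \<le> v + d/2"
      have "compact {a..x}" "{a..x} \<noteq> {}" "continuous_on {a..x} f"
        using x by (auto intro: continuous_on_subset[OF f])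
      \<comment> \<open>At a maximum point \<open>m\<close> the inequality over one short step reads
        f m \<le> f m / 2.\<close>
      then obtain m where m: "m \<in> {a..x}" "\<And>y. y \<in> {a..x} \<Longrightarrow> f y \<le> f m"
        using continuous_attains_sup[of "{a..x}" f] by blast
      have mab: "m \<in> {a..b}" using m x by auto
      have "f m \<le> 0"
      proof (cases "m \<le> v")
        case True
        then show ?thesis using IH[OF mab] by simp
      next
        case False
        have vab: "v \<in> {a..b}" using False va mab by auto
        have sub: "{v..m} \<subseteq> {a..b}" using vab mab by auto
        have "integral {a..m} (\<lambda>t. f t * n t) - integral {a..v} (\<lambda>t. f t * n t) = integral {v..m} (\<lambda>t. f t * n t)"
          using integral_difference_real[OF nfi, of v m] vab mab False by auto
        moreover have "integral {a..v} (\<lambda>t. f t * n t) = 0"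
          using vab by (intro integral_unique has_integral_is_0) (auto simp: IH)
        ultimately have "f m \<le> integral {v..m} (\<lambda>t. f t * n t)" using le[OF mab] by simp
        also have "\<dots> \<le> integral {v..m} (\<lambda>t. f m * n t)"
        proof (rule integral_le)
          show "(\<lambda>t. f t * n t) integrable_on {v..m}" by (rule integrable_on_subinterval[OF nfi sub])
          show "(\<lambda>t. f m * n t) integrable_on {v..m}"
            by (rule integrable_on_mult_right[OF integrable_on_subinterval[OF ni sub]])
          show "f t * n t \<le> f m * n t" if "t \<in> {v..m}" for t
            using m that vab mab n0 by (intro mult_right_mono) auto
        qed
        also have "\<dots> = f m * (integral {a..m} n - integral {a..v} n)"
          using integral_difference_real[OF ni, of v m] vab mab False by simp
        also have "\<dots> \<le> f m * (1/2)"
        proof (rule mult_left_mono)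
          have "dist m v < d" using False m x d(1) by (auto simp: dist_real_def)
          then show "integral {a..m} n - integral {a..v} n \<le> 1/2"
            using d(2)[OF vab mab] unfolding dist_real_def by linarith
        qed (rule f0[OF mab])
        finally show ?thesis by simp
      qed
      then have "f x \<le> 0" using m(2)[of x] x by auto
      then show "f x = 0" using f0[of x] x by auto
    qed
  qed
  obtain j where "(x - a) / (d/2) \<le> real j" using real_arch_simple by blast
  then have "x \<le> a + real j * (d/2)" using d(1) by (simp add: field_simps)
  then show ?thesis using P[of j] x by blast
qed

text \<open>The common source of the closure properties below: Lipschitz images, vectors with
  absolutely continuous components, and products all have increments controlled by those of finitely
  many absolutely continuous functions.\<close>

lemma absolutely_continuous_on_Icc_dominated:
  fixes f :: "real \<Rightarrow> 'a::real_normed_vector" and g :: "'i \<Rightarrow> real \<Rightarrow> 'b::real_normed_vector"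
  assumes I: "finite I" and g: "\<And>i. i \<in> I \<Longrightarrow> absolutely_continuous_on_Icc a b (g i)"
    and C: "C \<ge> 0"
    and le: "\<And>u v. a \<le> u \<Longrightarrow> u \<le> v \<Longrightarrow> v \<le> b \<Longrightarrow> norm (f v - f u) \<le> C * (\<Sum>i\<in>I. norm (g i v - g i u))"
  shows "absolutely_continuous_on_Icc a b f"
  unfolding absolutely_continuous_on_Icc_iff
proof (intro allI impI)
  fix e :: real assume e: "e > 0"
  \<comment> \<open>The added ones keep the denominator positive for \<open>C = 0\<close> or empty
    \<open>I\<close> and make the final inequality strict.\<close>
  define e' where "e' = e / ((C + 1) * (real (card I) + 1))"
  have e': "e' > 0" using e C by (simp add: e'_def)
  have "\<exists>\<delta>. \<delta> > 0 \<and> (\<forall>P. subinterval_family a b P \<longrightarrow> (\<Sum>(u, v)\<in>P. v - u) < \<delta> \<longrightarrow>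
      (\<Sum>(u, v)\<in>P. norm (g i v - g i u)) < e')" if "i \<in> I" for i
    using g[OF that] e' unfolding absolutely_continuous_on_Icc_iff by blast
  then obtain \<delta> where \<delta>: "\<And>i. i \<in> I \<Longrightarrow> \<delta> i > 0"
    "\<And>i P. i \<in> I \<Longrightarrow> subinterval_family a b P \<Longrightarrow> (\<Sum>(u, v)\<in>P. v - u) < \<delta> i \<Longrightarrow>
      (\<Sum>(u, v)\<in>P. norm (g i v - g i u)) < e'"
    by metis
  define d where "d = Min (insert 1 (\<delta> ` I))"
  have d: "d > 0" "\<And>i. i \<in> I \<Longrightarrow> d \<le> \<delta> i" using I \<delta>(1) by (auto simp: d_def)
  show "\<exists>\<delta>>0. \<forall>P. subinterval_family a b P \<longrightarrow> (\<Sum>(u, v)\<in>P. v - u) < \<delta> \<longrightarrow>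
      (\<Sum>(u, v)\<in>P. norm (f v - f u)) < e"
  proof (intro exI[of _ d] conjI allI impI d(1))
    fix P assume P: "subinterval_family a b P" "(\<Sum>(u, v)\<in>P. v - u) < d"
    have "(\<Sum>(u, v)\<in>P. norm (f v - f u)) \<le> (\<Sum>(u, v)\<in>P. C * (\<Sum>i\<in>I. norm (g i v - g i u)))"
      by (rule sum_mono) (use P(1) le in \<open>auto simp: subinterval_family_def\<close>)
    also have "\<dots> = C * (\<Sum>i\<in>I. (\<Sum>(u, v)\<in>P. norm (g i v - g i u)))"
      unfolding split_def sum_distrib_left[symmetric] by (subst sum.swap) simp
    also have "\<dots> \<le> C * (\<Sum>i\<in>I. e')"
    proof (rule mult_left_mono[OF sum_mono C])
      fix i assume i: "i \<in> I"
      show "(\<Sum>(u, v)\<in>P. norm (g i v - g i u)) \<le> e'"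
        using \<delta>(2)[OF i P(1) order.strict_trans2[OF P(2) d(2)[OF i]]] by (rule less_imp_le)
    qed
    also have "\<dots> = C * real (card I) * e'" by simp
    also have "\<dots> < (C + 1) * (real (card I) + 1) * e'"
    proof (rule mult_strict_right_mono[OF _ e'])
      have "(C + 1) * (real (card I) + 1) = C * real (card I) + (C + (real (card I) + 1))"
        by (simp add: algebra_simps)
      then show "C * real (card I) < (C + 1) * (real (card I) + 1)" using C by simp
    qed
    also have "\<dots> = e" using C by (simp add: e'_def)
    finally show "(\<Sum>(u, v)\<in>P. norm (f v - f u)) < e" .
  qed
qed

lemma absolutely_continuous_on_Icc_Lipschitz_comp:
  fixes f :: "real \<Rightarrow> 'a::real_normed_vector" and g :: "real \<Rightarrow> 'b::real_normed_vector"
  assumes "absolutely_continuous_on_Icc a b g" "C \<ge> 0"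
    and "\<And>u v. a \<le> u \<Longrightarrow> u \<le> v \<Longrightarrow> v \<le> b \<Longrightarrow> norm (f v - f u) \<le> C * norm (g v - g u)"
  shows "absolutely_continuous_on_Icc a b f"
  by (rule absolutely_continuous_on_Icc_dominated[of "{()}" a b "\<lambda>_. g" C]) (use assms in auto)

lemma absolutely_continuous_on_Icc_vec:
  fixes f :: "real \<Rightarrow> 'a::real_normed_vector ^ 'n::finite"
  assumes "\<And>i. absolutely_continuous_on_Icc a b (\<lambda>x. f x $ i)"
  shows "absolutely_continuous_on_Icc a b f"
  by (rule absolutely_continuous_on_Icc_dominated[of UNIV a b "\<lambda>i x. f x $ i" 1])
     (use assms in \<open>auto simp: norm_vec_def intro: L2_set_le_sum\<close>)

lemma absolutely_continuous_on_Icc_mult: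
  fixes f g :: "real \<Rightarrow> 'a::real_normed_algebra"
  assumes f: "absolutely_continuous_on_Icc a b f" and g: "absolutely_continuous_on_Icc a b g"
    and cf: "continuous_on {a..b} f" and cg: "continuous_on {a..b} g"
  shows "absolutely_continuous_on_Icc a b (\<lambda>x. f x * g x)"
proof -
  obtain M where M: "M > 0" "\<And>x. x \<in> {a..b} \<Longrightarrow> norm (f x) \<le> M"
    using compact_imp_bounded[OF compact_continuous_image[OF cf compact_Icc]] unfolding bounded_pos by blast
  obtain N where N: "N > 0" "\<And>x. x \<in> {a..b} \<Longrightarrow> norm (g x) \<le> N"
    using compact_imp_bounded[OF compact_continuous_image[OF cg compact_Icc]] unfolding bounded_pos by blast
  show ?thesis
  proof (rule absolutely_continuous_on_Icc_dominated[of "UNIV :: bool set" a b "\<lambda>i. if i then f else g" "M + N"])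
    show "absolutely_continuous_on_Icc a b (if i then f else g)" for i using f g by simp
    fix u v assume uv: "a \<le> u" "u \<le> v" "v \<le> b"
    have "norm (f v * g v - f u * g u) = norm ((f v - f u) * g v + f u * (g v - g u))"
      by (simp add: algebra_simps)
    also have "\<dots> \<le> norm (f v - f u) * norm (g v) + norm (f u) * norm (g v - g u)"
      by (rule order_trans[OF norm_triangle_ineq add_mono[OF norm_mult_ineq norm_mult_ineq]])
    also have "\<dots> \<le> norm (f v - f u) * (M + N) + (M + N) * norm (g v - g u)"
    proof -
      have "norm (f u) \<le> M" "norm (g v) \<le> N" using M(2)[of u] N(2)[of v] uv by auto
      then have "norm (f u) \<le> M + N" "norm (g v) \<le> M + N" using M(1) N(1) by linarith+
      then show ?thesis by (intro add_mono mult_left_mono mult_right_mono) auto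
    qed
    finally show "norm (f v * g v - f u * g u) \<le> (M + N) * (\<Sum>i\<in>UNIV. norm ((if i then f else g) v - (if i then f else g) u))"
      by (simp add: UNIV_bool algebra_simps)
  qed (use M N in auto)
qed

lemma absolutely_continuous_on_Icc_indefinite_integralI:
  fixes f :: "real \<Rightarrow> 'a::euclidean_space"
  assumes "f absolutely_integrable_on {a..b}"
    and "\<And>x. x \<in> {a..b} \<Longrightarrow> F x = C + integral {a..x} f"
  shows "absolutely_continuous_on_Icc a b F"
  by (rule absolutely_continuous_on_Icc_Lipschitz_comp[OF absolutely_continuous_on_Icc_indefinite_integral[OF assms(1)], of 1])
     (use assms(2) in auto)

lemma absolutely_continuous_on_Icc_exp:
  fixes c :: complex
  shows "absolutely_continuous_on_Icc a b (\<lambda>x. exp (c * of_real x))"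
proof (rule absolutely_continuous_on_Icc_indefinite_integralI)
  show "(\<lambda>x. c * exp (c * of_real x)) absolutely_integrable_on {a..b}"
    by (intro absolutely_integrable_continuous_real continuous_intros)
  fix x assume x: "x \<in> {a..b}"
  have "((\<lambda>x. c * exp (c * of_real x)) has_integral exp (c * of_real x) - exp (c * of_real a)) {a..x}"
    using x by (intro fundamental_theorem_of_calculus)
      (auto intro!: derivative_eq_intros has_vector_derivative_real_field simp: mult.commute)
  from integral_unique[OF this, symmetric]
  show "exp (c * of_real x) = exp (c * of_real a) + integral {a..x} (\<lambda>x. c * exp (c * of_real x))"
    by (simp only: diff_eq_eq add.commute)
qed

lemma absolutely_continuous_on_Icc_imp_continuous_on:
  assumes "absolutely_continuous_on_Icc a b f"
  shows "continuous_on {a..b} f"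
  unfolding continuous_on_iff
proof (intro ballI allI impI)
  fix x e :: real assume x: "x \<in> {a..b}" and e: "e > 0"
  obtain \<delta> where \<delta>: "\<delta> > 0" "\<And>P. subinterval_family a b P \<Longrightarrow> (\<Sum>(u, v)\<in>P. v - u) < \<delta> \<Longrightarrow>
      (\<Sum>(u, v)\<in>P. norm (f v - f u)) < e"
    using absolutely_continuous_on_IccE[OF assms e] by blast
  have "dist (f y) (f x) < e" if y: "y \<in> {a..b}" "dist y x < \<delta>" for y
  proof (cases "x \<le> y")
    case True
    then show ?thesis using \<delta>(2)[of "{(x, y)}"] x y by (simp add: dist_norm subinterval_family_def)
  next
    case False
    then show ?thesis using \<delta>(2)[of "{(y, x)}"] x y by (simp add: dist_norm norm_minus_commute subinterval_family_def)
  qed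
  then show "\<exists>d>0. \<forall>x'\<in>{a..b}. dist x' x < d \<longrightarrow> dist (f x') (f x) < e" using \<delta>(1) by blast
qed

lemma absolutely_continuous_on_Icc_subset:
  assumes "absolutely_continuous_on_Icc a b f" "a \<le> c" "d \<le> b"
  shows "absolutely_continuous_on_Icc c d f"
proof -
  have "subinterval_family a b P" if "subinterval_family c d P" for P
    using that assms(2,3) unfolding subinterval_family_def by force
  then show ?thesis using assms(1) unfolding absolutely_continuous_on_Icc_iff by meson
qed

section \<open>Sectors\<close>

lemma connected_nonzero_constant_sign:
  fixes f :: "'a::topological_space \<Rightarrow> real"
  assumes "connected D" "continuous_on D f" "\<And>x. x \<in> D \<Longrightarrow> f x \<noteq> 0"
  shows "(\<forall>x\<in>D. f x > 0) \<or> (\<forall>x\<in>D. f x < 0)"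
proof (rule ccontr)
  assume "\<not> ?thesis"
  then obtain x y where xy: "x \<in> D" "y \<in> D" "f x < 0" "f y > 0"
    using assms(3) by (metis linorder_neqE)
  have "connected (f ` D)" using assms connected_continuous_image by blast
  then have "0 \<in> f ` D" using connectedD_interval[of "f ` D" "f x" "f y" 0] xy by auto
  then show False using assms(3) by auto
qed

lemma open_sectorI: "\<rho> > 0 \<Longrightarrow> \<phi>1 < \<theta> \<Longrightarrow> \<theta> < \<phi>2 \<Longrightarrow> complex_of_real \<rho> * cis \<theta> \<in> open_sector \<phi>1 \<phi>2"
  unfolding open_sector_def by blast

lemma open_sectorE:
  assumes "z \<in> open_sector \<phi>1 \<phi>2"
  obtains \<rho> \<theta> where "\<rho> > 0" "\<phi>1 < \<theta>" "\<theta> < \<phi>2" "z = complex_of_real \<rho> * cis \<theta>"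
  using assms unfolding open_sector_def by blast

text \<open>On the full sector the real part has constant sign, the sector being connected and
  meeting no separating line. The directions of \<open>S\<close> lie in a compact arc inside it,
  where the absolute value has a positive minimum; homogeneity turns this into a bound proportional
  to \<open>norm lam\<close>, and a minimum over the finitely many pairs makes \<open>c\<close>
  uniform.\<close>

lemma strictly_embedded_sector_separation:
  assumes S: "strictly_embedded_sector r b S"
    and b: "\<And>j k. j \<in> {1..r} \<Longrightarrow> k \<in> {1..r} \<Longrightarrow> j \<noteq> k \<Longrightarrow> b j \<noteq> b k"
  obtains c where "c > 0" "\<And>j k. j \<in> {1..r} \<Longrightarrow> k \<in> {1..r} \<Longrightarrow> j \<noteq> k \<Longrightarrow>
      (\<forall>lam\<in>S. Re (\<i> * (b j - b k) * lam) \<ge> c * norm lam) \<or> (\<forall>lam\<in>S. Re (\<i> * (b j - b k) * lam) \<le> - c * norm lam)"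
proof -
  obtain \<phi>1 \<phi>2 \<epsilon>1 \<epsilon>2 where \<phi>: "is_sector_of r b \<phi>1 \<phi>2" "\<epsilon>1 > 0" "\<epsilon>2 > 0"
    "\<phi>1 + \<epsilon>1 < \<phi>2 - \<epsilon>2" and Seq: "S = open_sector (\<phi>1 + \<epsilon>1) (\<phi>2 - \<epsilon>2)"
    using S unfolding strictly_embedded_sector_def by blast
  define D where "D = open_sector \<phi>1 \<phi>2"
  have comp: "D \<in> components (UNIV - {0} - \<Union> {separating_line b j k | j k. j \<in> {1..r} \<and> k \<in> {1..r} \<and> j \<noteq> k})"
    using \<phi>(1) unfolding is_sector_of_def D_def .
  have conn: "connected D" using comp in_components_connected by blast
  have one: "\<exists>c>0. (\<forall>lam\<in>S. Re (\<i> * (b j - b k) * lam) \<ge> c * norm lam) \<or> (\<forall>lam\<in>S. Re (\<i> * (b j - b k) * lam) \<le> - c * norm lam)"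
    if jk: "j \<in> {1..r}" "k \<in> {1..r}" "j \<noteq> k" for j k
  proof -
    define f where "f lam = Re (\<i> * (b j - b k) * lam)" for lam
    have cont: "continuous_on A f" for A unfolding f_def by (intro continuous_intros)
    have "f lam \<noteq> 0" if "lam \<in> D" for lam
    proof -
      have "lam \<notin> separating_line b j k" using in_components_subset[OF comp] that jk by blast
      then show ?thesis by (simp add: separating_line_def f_def algebra_simps)
    qed
    then have sgn: "(\<forall>lam\<in>D. f lam > 0) \<or> (\<forall>lam\<in>D. f lam < 0)"
      by (intro connected_nonzero_constant_sign conn cont)
    \<comment> \<open>The closed range of angles still lies strictly between \<phi>1 and \<phi>2,
      because both \<epsilon>1 and \<epsilon>2 are positive.\<close>
    define T where "T = {\<phi>1 + \<epsilon>1..\<phi>2 - \<epsilon>2}"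
    have T: "compact T" "T \<noteq> {}" using \<phi> by (auto simp: T_def)
    have cisD: "cis t \<in> D" if "t \<in> T" for t
      using open_sectorI[of 1 \<phi>1 t \<phi>2] that \<phi> unfolding D_def T_def by auto
    have "continuous_on T (\<lambda>t. \<bar>f (cis t)\<bar>)"
      unfolding f_def by (intro continuous_intros continuous_on_cis)
    then obtain t0 where t0: "t0 \<in> T" "\<And>t. t \<in> T \<Longrightarrow> \<bar>f (cis t0)\<bar> \<le> \<bar>f (cis t)\<bar>"
      using continuous_attains_inf[OF T] by blast
    define c where "c = \<bar>f (cis t0)\<bar>"
    have c: "c > 0" using sgn cisD[OF t0(1)] by (auto simp: c_def)
    have pol: "\<exists>\<rho> t. \<rho> > 0 \<and> t \<in> T \<and> lam = of_real \<rho> * cis t" if lam: "lam \<in> S" for lam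
    proof -
      obtain \<rho> t where "\<rho> > 0" "\<phi>1 + \<epsilon>1 < t" "t < \<phi>2 - \<epsilon>2" "lam = of_real \<rho> * cis t"
        using lam unfolding Seq by (rule open_sectorE)
      then show ?thesis unfolding T_def by (intro exI[of _ \<rho>] exI[of _ t]) auto
    qed
    have fpol: "f (of_real \<rho> * cis t) = \<rho> * f (cis t)" for \<rho> t
      unfolding f_def by (simp add: algebra_simps)
    have abs: "\<bar>f lam\<bar> \<ge> c * norm lam" "lam \<in> D" if lam: "lam \<in> S" for lam
    proof -
      obtain \<rho> t where p: "\<rho> > 0" "t \<in> T" "lam = of_real \<rho> * cis t" using pol[OF lam] by blast
      have "\<rho> * c \<le> \<rho> * \<bar>f (cis t)\<bar>" using t0(2)[OF p(2)] p(1) unfolding c_def by (intro mult_left_mono) auto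
      then show "\<bar>f lam\<bar> \<ge> c * norm lam" using p(1) unfolding p(3) fpol by (simp add: abs_mult norm_mult mult.commute)
      show "lam \<in> D" unfolding p(3) D_def using p(1,2) \<phi> by (intro open_sectorI) (auto simp: T_def)
    qed
    from sgn show ?thesis
    proof
      assume *: "\<forall>lam\<in>D. f lam > 0"
      have "f lam \<ge> c * norm lam" if "lam \<in> S" for lam
        using abs(1)[OF that] bspec[OF * abs(2)[OF that]] by simp
      then show ?thesis using c unfolding f_def by blast
    next
      assume *: "\<forall>lam\<in>D. f lam < 0"
      have "f lam \<le> - c * norm lam" if "lam \<in> S" for lam
        using abs(1)[OF that] bspec[OF * abs(2)[OF that]] by simp
      then show ?thesis using c unfolding f_def by blast
    qed
  qed
  define P where "P p c \<longleftrightarrow> c > 0 \<and> ((\<forall>lam\<in>S. Re (\<i> * (b (fst p) - b (snd p)) * lam) \<ge> c * norm lam) \<or>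
      (\<forall>lam\<in>S. Re (\<i> * (b (fst p) - b (snd p)) * lam) \<le> - c * norm lam))" for p c
  define I where "I = {p \<in> {1..r} \<times> {1..r}. fst p \<noteq> snd p}"
  have "finite I" unfolding I_def by (rule finite_subset[of _ "{1..r} \<times> {1..r}"]) auto
  have "\<exists>c. P p c" if "p \<in> I" for p
    unfolding P_def by (rule one) (use that in \<open>auto simp: I_def\<close>)
  then have "\<forall>p\<in>I. \<exists>c. P p c" by blast
  then obtain c where c: "\<forall>p\<in>I. P p (c p)" by (rule bchoice[THEN exE])
  then have cpos: "\<And>p. p \<in> I \<Longrightarrow> c p > 0" unfolding P_def by blast
  \<comment> \<open>The inserted 1 covers the case of a single block, where there are no
    pairs.\<close>
  define c0 where "c0 = Min (insert 1 (c ` I))"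
  have c0: "c0 > 0" "\<And>p. p \<in> I \<Longrightarrow> c0 \<le> c p" using \<open>finite I\<close> cpos by (auto simp: c0_def)
  show ?thesis
  proof (rule that[OF c0(1)])
    fix j k assume "j \<in> {1..r}" "k \<in> {1..r}" "j \<noteq> k"
    then have jk: "(j, k) \<in> I" by (simp add: I_def)
    have le: "c0 * norm lam \<le> c (j,k) * norm lam" for lam :: complex
      by (intro mult_right_mono c0 jk) auto
    have "(\<forall>lam\<in>S. Re (\<i> * (b j - b k) * lam) \<ge> c (j,k) * norm lam) \<or>
        (\<forall>lam\<in>S. Re (\<i> * (b j - b k) * lam) \<le> - c (j,k) * norm lam)"
      using bspec[OF c jk] unfolding P_def fst_conv snd_conv by (rule conjunct2)
    then show "(\<forall>lam\<in>S. Re (\<i> * (b j - b k) * lam) \<ge> c0 * norm lam) \<or>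
        (\<forall>lam\<in>S. Re (\<i> * (b j - b k) * lam) \<le> - c0 * norm lam)"
    proof (elim disjE)
      assume "\<forall>lam\<in>S. Re (\<i> * (b j - b k) * lam) \<ge> c (j,k) * norm lam"
      then show ?thesis using order_trans[OF le] by blast
    next
      assume *: "\<forall>lam\<in>S. Re (\<i> * (b j - b k) * lam) \<le> - c (j,k) * norm lam"
      have "Re (\<i> * (b j - b k) * lam) \<le> - c0 * norm lam" if "lam \<in> S" for lam
        using bspec[OF * that] le[of lam] unfolding mult_minus_left by linarith
      then show ?thesis by blast
    qed
  qed
qed

lemma strictly_embedded_sector_nonempty:
  assumes "strictly_embedded_sector r b S"
  obtains lam where "lam \<in> S"
proof -
  obtain \<psi>1 \<psi>2 where S: "S = open_sector \<psi>1 \<psi>2" "\<psi>1 < \<psi>2"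
    using assms unfolding strictly_embedded_sector_def by blast
  have "of_real 1 * cis ((\<psi>1 + \<psi>2) / 2) \<in> S" unfolding S(1) using S(2)
    by (intro open_sectorI) auto
  then show ?thesis by (rule that)
qed

lemma strictly_embedded_sector_nonzero:
  assumes "strictly_embedded_sector r b S" "lam \<in> S"
  shows "lam \<noteq> 0"
  using assms unfolding strictly_embedded_sector_def by clarsimp (erule open_sectorE, simp)

lemma sorting_permutation:
  fixes f :: "nat \<Rightarrow> 'a::linorder"
  assumes "inj_on f {1..r}"
  obtains \<sigma> where "\<sigma> permutes {1..r}" "strict_mono_on {1..r} (\<lambda>m. f (\<sigma> m))"
proof -
  define M where "M = f ` {1..r}"
  have M: "finite M" "card M = r" using card_image[OF assms] by (auto simp: M_def)
  define xs where "xs = sorted_list_of_set M"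
  have xs: "set xs = M" "length xs = r" and ss: "sorted_wrt (<) xs" using M by (auto simp: xs_def)
  \<comment> \<open>The label whose value has rank \<open>m\<close>. The shift reconciles labels
    starting at 1 with list positions starting at 0, and \<open>permutes\<close> asks for the
    identity outside the labels.\<close>
  define \<sigma> where "\<sigma> m = (if m \<in> {1..r} then inv_into {1..r} f (xs ! (m - 1)) else m)" for m
  have inM: "xs ! (m - 1) \<in> f ` {1..r}" if "m \<in> {1..r}" for m
    using that xs nth_mem[of "m - 1" xs] by (auto simp: M_def)
  have f\<sigma>: "f (\<sigma> m) = xs ! (m - 1)" if "m \<in> {1..r}" for m
    using that f_inv_into_f[OF inM[OF that]] by (simp add: \<sigma>_def)
  have mono: "strict_mono_on {1..r} (\<lambda>m. f (\<sigma> m))"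
  proof (rule strict_mono_onI)
    fix m m' assume m: "m \<in> {1..r}" "m' \<in> {1..r}" "m < m'"
    then have "xs ! (m - 1) < xs ! (m' - 1)"
      using sorted_wrt_nth_less[OF ss, of "m - 1" "m' - 1"] xs(2) by auto
    then show "f (\<sigma> m) < f (\<sigma> m')" using f\<sigma> m by simp
  qed
  have "inj_on \<sigma> {1..r}"
    using strict_mono_on_imp_inj_on[OF mono] by (rule inj_on_imageI2[of f \<sigma>, unfolded o_def])
  moreover have sub: "\<sigma> ` {1..r} \<subseteq> {1..r}" using inv_into_into[OF inM] by (auto simp: \<sigma>_def)
  ultimately have "bij_betw \<sigma> {1..r} {1..r}"
    unfolding bij_betw_def using endo_inj_surj[of "{1..r}" \<sigma>] by blast
  then have "\<sigma> permutes {1..r}" by (rule bij_imp_permutes) (auto simp: \<sigma>_def)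
  then show ?thesis using mono that by blast
qed

text \<open>The outcome of every pairwise comparison is the same throughout \<open>S\<close>, so a
  permutation that sorts the values at one point \<open>lam0\<close> sorts them everywhere.\<close>

lemma strictly_embedded_sector_ordering:
  assumes S: "strictly_embedded_sector r b S"
    and b: "\<And>j k. j \<in> {1..r} \<Longrightarrow> k \<in> {1..r} \<Longrightarrow> j \<noteq> k \<Longrightarrow> b j \<noteq> b k"
  shows "\<exists>\<sigma>. \<sigma> permutes {1..r} \<and> (\<forall>lam\<in>S. strict_mono_on {1..r} (\<lambda>m. Re (\<i> * b (\<sigma> m) * lam)))"
proof -
  obtain c where c: "c > 0" "\<And>j k. j \<in> {1..r} \<Longrightarrow> k \<in> {1..r} \<Longrightarrow> j \<noteq> k \<Longrightarrow>
      (\<forall>lam\<in>S. Re (\<i> * (b j - b k) * lam) \<ge> c * norm lam) \<or> (\<forall>lam\<in>S. Re (\<i> * (b j - b k) * lam) \<le> - c * norm lam)"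
    by (rule strictly_embedded_sector_separation[OF S b]) auto
  obtain lam0 where lam0: "lam0 \<in> S" by (rule strictly_embedded_sector_nonempty[OF S])
  define f where "f lam j = Re (\<i> * b j * lam)" for lam j
  have diff: "Re (\<i> * (b j - b k) * lam) = f lam j - f lam k" for j k lam
    by (simp add: f_def algebra_simps)
  have pos: "c * norm lam > 0" if "lam \<in> S" for lam
    using strictly_embedded_sector_nonzero[OF S that] c(1) by simp
  have cases: "(\<forall>lam\<in>S. f lam j > f lam k) \<or> (\<forall>lam\<in>S. f lam j < f lam k)"
    if "j \<in> {1..r}" "k \<in> {1..r}" "j \<noteq> k" for j k
    using c(2)[OF that]
  proof
    assume *: "\<forall>lam\<in>S. c * norm lam \<le> Re (\<i> * (b j - b k) * lam)"
    have "f lam j > f lam k" if "lam \<in> S" for lam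
      using pos[OF that] bspec[OF * that] unfolding diff by linarith
    then show ?thesis by blast
  next
    assume *: "\<forall>lam\<in>S. Re (\<i> * (b j - b k) * lam) \<le> - c * norm lam"
    have "f lam j < f lam k" if "lam \<in> S" for lam
      using pos[OF that] bspec[OF * that] unfolding diff mult_minus_left by linarith
    then show ?thesis by blast
  qed
  have "inj_on (f lam0) {1..r}"
  proof (rule inj_onI, rule ccontr)
    fix j k assume "j \<in> {1..r}" "k \<in> {1..r}" "f lam0 j = f lam0 k" "j \<noteq> k"
    then show False using cases[of j k] lam0 by auto
  qed
  then obtain \<sigma> where \<sigma>: "\<sigma> permutes {1..r}" "strict_mono_on {1..r} (\<lambda>m. f lam0 (\<sigma> m))"
    by (rule sorting_permutation)
  have "strict_mono_on {1..r} (\<lambda>m. f lam (\<sigma> m))" if lam: "lam \<in> S" for lam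
  proof (rule strict_mono_onI)
    fix m m' assume m: "m \<in> {1..r}" "m' \<in> {1..r}" "m < m'"
    have lt: "f lam0 (\<sigma> m) < f lam0 (\<sigma> m')" using strict_mono_onD[OF \<sigma>(2) m] .
    have in': "\<sigma> m \<in> {1..r}" "\<sigma> m' \<in> {1..r}" using permutes_in_image[OF \<sigma>(1)] m by auto
    have "\<sigma> m \<noteq> \<sigma> m'" using lt by auto
    from cases[OF in' this] show "f lam (\<sigma> m) < f lam (\<sigma> m')"
      using lt lam lam0 by (meson less_asym)
  qed
  then show ?thesis using \<sigma>(1) unfolding f_def by blast
qed

section \<open>The first-order system\<close>

lemma bounded_linear_axis: "bounded_linear (axis i :: 'a::euclidean_space \<Rightarrow> 'a ^ 'n::finite)"
  unfolding linear_conv_bounded_linear[symmetric]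
  by (rule linearI) (auto simp: axis_def vec_eq_iff)

lemma bounded_linear_vector_scalar_mult: "bounded_linear (\<lambda>v::complex ^ 'n::finite. c *s v)"
  unfolding linear_conv_bounded_linear[symmetric]
  by (rule linearI) (auto simp: vec_eq_iff algebra_simps)

lemma sum_axis_nth: "(\<Sum>i\<in>UNIV. axis i (v $ i)) = (v :: 'a::comm_monoid_add ^ 'n::finite)"
  by (simp add: vec_eq_iff axis_def if_distrib[where f = "\<lambda>f. f _"] cong: if_cong)

lemma has_vector_derivative_cart:
  fixes f :: "real \<Rightarrow> 'a::euclidean_space ^ 'n::finite"
  assumes "\<And>i. ((\<lambda>x. f x $ i) has_vector_derivative f' $ i) F"
  shows "(f has_vector_derivative f') F"
proof -
  have "((\<lambda>x. \<Sum>i\<in>UNIV. axis i (f x $ i)) has_vector_derivative (\<Sum>i\<in>UNIV. axis i (f' $ i))) F"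
    by (intro has_vector_derivative_sum bounded_linear.has_vector_derivative[OF bounded_linear_axis] assms)
  then show ?thesis by (simp add: sum_axis_nth)
qed

lemma AE_lebesgue_negligible:
  assumes "AE x\<in>A in lebesgue. P x"
  obtains N where "negligible N" "\<And>x. x \<in> A - N \<Longrightarrow> P x"
  using assms unfolding eventually_ae_filter negligible_iff_null_sets by auto

lemma AE_lebesgueI_negligible:
  assumes "negligible N" "\<And>x. x \<in> A - N \<Longrightarrow> P x"
  shows "AE x\<in>A in lebesgue. P x"
  using assms unfolding eventually_ae_filter negligible_iff_null_sets by auto

lemma norm_vec_le_sum: "norm (v :: 'a::real_normed_vector ^ 'n::finite) \<le> (\<Sum>i\<in>UNIV. norm (v $ i))"
  by (simp add: norm_vec_def L2_set_le_sum)

text \<open>Since \<open>inverse 0 = 0\<close>, a zero among the \<open>b (blk i)\<close> would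
  produce a zero row.\<close>

lemma invertible_block_diag_inv:
  assumes "invertible (block_diag_inv blk b)"
  shows "b (blk i) \<noteq> 0"
proof
  assume 0: "b (blk i) = 0"
  obtain A where "block_diag_inv blk b ** A = mat 1" using assms unfolding invertible_def by blast
  then have "(block_diag_inv blk b ** A) $ i $ i = 1" by (simp add: mat_def)
  moreover have "(block_diag_inv blk b ** A) $ i $ i = 0"
    using 0 by (auto simp: matrix_matrix_mult_def block_diag_inv_def intro!: sum.neutral)
  ultimately show False by simp
qed

locale block_system =
  fixes r :: nat and blk :: "'n::finite \<Rightarrow> nat" and b :: "nat \<Rightarrow> complex"
    and Q :: "real \<Rightarrow> complex ^ 'n ^ 'n"
  assumes blk_range: "range blk = {1..r}"
    and b_nonzero: "\<And>i. b (blk i) \<noteq> 0"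
    and b_distinct: "\<And>j k. j \<in> {1..r} \<Longrightarrow> k \<in> {1..r} \<Longrightarrow> j \<noteq> k \<Longrightarrow> b j \<noteq> b k"
    and Q_L1: "Q absolutely_integrable_on {0..1}"
    and Q_diagonal_zero: "\<And>i l. blk i = blk l \<Longrightarrow> AE x\<in>{0..1} in lebesgue. Q x $ i $ l = 0"
begin

text \<open>The equation solved for the derivative, y' = i B^(-1) (lam - Q) y; the diagonal of the
  inverse of B is formed by the \<open>b (blk i)\<close>.\<close>

definition rhs :: "complex \<Rightarrow> real \<Rightarrow> complex ^ 'n \<Rightarrow> complex ^ 'n" where
  "rhs lam t v = (\<chi> i. \<i> * b (blk i) * (lam * v $ i - (Q t *v v) $ i))"

lemma equation_iff_rhs:
  "(- \<i>) *s (block_diag_inv blk b *v y') + Q t *v v = lam *s v \<longleftrightarrow> y' = rhs lam t v"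
proof -
  have 1: "(block_diag_inv blk b *v y') $ i = inverse (b (blk i)) * y' $ i" for i
    by (simp add: matrix_vector_mult_def block_diag_inv_def if_distrib[where f = "\<lambda>x. x * _"] cong: if_cong)
  have 2: "- \<i> * (inverse (b (blk i)) * y' $ i) + q = lam * v $ i \<longleftrightarrow> y' $ i = \<i> * b (blk i) * (lam * v $ i - q)" for i q
  proof -
    have "\<i> * b (blk i) * (- \<i> * (inverse (b (blk i)) * y' $ i)) = y' $ i"
      using b_nonzero[of i] by (simp add: field_simps)
    moreover have "\<i> * b (blk i) \<noteq> 0" using b_nonzero by simp
    ultimately show ?thesis by (metis add_diff_cancel_right' diff_add_cancel mult_left_cancel)
  qed
  show ?thesis
    unfolding vec_eq_iff rhs_def by (simp only: vector_add_component vector_smult_component 1 2 vec_lambda_beta)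
qed

lemma rhs_diff: "rhs lam t (u - v) = rhs lam t u - rhs lam t v"
  by (simp add: rhs_def vec_eq_iff matrix_vector_mult_diff_distrib algebra_simps)

lemma rhs_smult: "rhs lam t (c *s v) = c *s rhs lam t v"
  by (simp add: rhs_def vec_eq_iff matrix_vector_mult_def sum_distrib_left algebra_simps)

lemma rhs_add: "rhs lam t (u + v) = rhs lam t u + rhs lam t v"
  by (simp add: rhs_def vec_eq_iff matrix_vector_right_distrib algebra_simps)

lemma rhs_zero: "rhs lam t 0 = 0"
  by (simp add: rhs_def vec_eq_iff)

lemma rhs_sum: "rhs lam t (\<Sum>i\<in>I. f i) = (\<Sum>i\<in>I. rhs lam t (f i))"
  by (induction I rule: infinite_finite_induct) (auto simp: rhs_zero rhs_add)

text \<open>An integrable Lipschitz constant of \<open>rhs lam t\<close>, the weight for Gronwall. A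
  sum over entries is used in place of an operator norm, since its integrability can be read off
  entrywise.\<close>

definition coefficient_bound :: "complex \<Rightarrow> real \<Rightarrow> real" where
  "coefficient_bound lam t = (\<Sum>i\<in>UNIV. norm (b (blk i)) * (norm lam + (\<Sum>m\<in>UNIV. norm (Q t $ i $ m))))"

lemma Q_entry_absolutely_integrable: "(\<lambda>t. Q t $ i $ m) absolutely_integrable_on {0..1}"
proof -
  have "bounded_linear (\<lambda>M :: complex ^ 'n ^ 'n. M $ i $ m)"
    by (rule bounded_linear_compose[OF bounded_linear_vec_nth bounded_linear_vec_nth])
  from absolutely_integrable_linear[OF Q_L1 this] show ?thesis by (simp add: o_def)
qed

lemma coefficient_bound_absolutely_integrable: "coefficient_bound lam absolutely_integrable_on {0..1}"
  unfolding coefficient_bound_def[abs_def]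
  by (intro absolutely_integrable_sum absolutely_integrable_continuous_mult set_integral_add(1)
       absolutely_integrable_norm[unfolded o_def] Q_entry_absolutely_integrable absolutely_integrable_continuous_real
       continuous_intros finite_class.finite_UNIV)

lemma coefficient_bound_nonneg: "coefficient_bound lam t \<ge> 0"
  unfolding coefficient_bound_def by (intro sum_nonneg mult_nonneg_nonneg add_nonneg_nonneg norm_ge_zero)

lemma norm_rhs_le: "norm (rhs lam t v) \<le> norm v * coefficient_bound lam t"
proof -
  have "norm (rhs lam t v $ i) \<le> norm v * (norm (b (blk i)) * (norm lam + (\<Sum>m\<in>UNIV. norm (Q t $ i $ m))))" for i
  proof -
    have "norm ((Q t *v v) $ i) \<le> (\<Sum>m\<in>UNIV. norm v * norm (Q t $ i $ m))"
      unfolding matrix_vector_mult_def vec_lambda_beta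
      by (rule sum_norm_le) (simp add: norm_mult mult.commute mult_right_mono Finite_Cartesian_Product.norm_nth_le)
    then have "norm (lam * v $ i - (Q t *v v) $ i) \<le> norm lam * norm v + norm v * (\<Sum>m\<in>UNIV. norm (Q t $ i $ m))"
      using norm_triangle_ineq4[of "lam * v $ i" "(Q t *v v) $ i"] mult_left_mono[OF Finite_Cartesian_Product.norm_nth_le[of v i], of "norm lam"]
      by (simp add: norm_mult sum_distrib_left)
    from mult_left_mono[OF this, of "norm (b (blk i))"]
    have "norm (b (blk i)) * norm (lam * v $ i - (Q t *v v) $ i) \<le>
        norm v * (norm (b (blk i)) * (norm lam + (\<Sum>m\<in>UNIV. norm (Q t $ i $ m))))"
      by (simp add: algebra_simps)
    then show ?thesis by (simp add: rhs_def norm_mult)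
  qed
  then have "(\<Sum>i\<in>UNIV. norm (rhs lam t v $ i)) \<le> norm v * coefficient_bound lam t"
    unfolding coefficient_bound_def sum_distrib_left by (intro sum_mono)
  then show ?thesis using norm_vec_le_sum order_trans by blast
qed

lemma solution_has_integral:
  assumes "caratheodory_solution (block_diag_inv blk b) Q lam y" and x: "x \<in> {0..1}"
  shows "((\<lambda>t. rhs lam t (y t)) has_integral y x - y 0) {0..x}"
proof -
  have AC: "absolutely_continuous_on_Icc 0 1 y"
    and AE: "AE x\<in>{0..1} in lebesgue. (y has_vector_derivative rhs lam x (y x)) (at x within {0..1})"
    using assms unfolding caratheodory_solution_def equation_iff_rhs by auto
  obtain N where N: "negligible N" "\<And>x. x \<in> {0..1} - N \<Longrightarrow> (y has_vector_derivative rhs lam x (y x)) (at x within {0..1})"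
    using AE by (rule AE_lebesgue_negligible) blast
  show ?thesis
  proof (rule absolutely_continuous_has_integral[OF _ _ N(1)])
    show "absolutely_continuous_on_Icc 0 x y"
      using absolutely_continuous_on_Icc_subset[OF AC, of 0 x] x by auto
    show "(y has_vector_derivative rhs lam t (y t)) (at t within {0..x})" if "t \<in> {0..x} - N" for t
      by (rule has_vector_derivative_within_subset[OF N(2)]) (use that x in auto)
  qed (use x in auto)
qed

text \<open>Stated for the integral equation and not for solutions, because the integral form passes
  to differences and linear combinations of solutions by linearity of the integral.\<close>

lemma integral_equation_zero:
  assumes cont: "continuous_on {0..1} w" and w0: "w 0 = 0"
    and int: "\<And>x. x \<in> {0..1} \<Longrightarrow> ((\<lambda>t. rhs lam t (w t)) has_integral w x - w 0) {0..x}"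
    and x: "x \<in> {0..1}"
  shows "w x = 0"
proof -
  have "norm (w x) = 0"
  proof (rule gronwall_zero[OF _ _ coefficient_bound_absolutely_integrable[of lam] _ _ x])
    show cn: "continuous_on {0..1} (\<lambda>x. norm (w x))" by (intro continuous_intros cont)
    fix y :: real assume y: "y \<in> {0..1}"
    have "norm (w y) = norm (integral {0..y} (\<lambda>t. rhs lam t (w t)))"
      using integral_unique[OF int[OF y]] w0 by simp
    also have "\<dots> \<le> integral {0..y} (\<lambda>t. norm (w t) * coefficient_bound lam t)"
    proof (rule integral_norm_bound_integral)
      show "(\<lambda>t. rhs lam t (w t)) integrable_on {0..y}" using int[OF y] by blast
      have "(\<lambda>t. norm (w t) * coefficient_bound lam t) integrable_on {0..1}"
        by (rule set_lebesgue_integral_eq_integral(1)[OF absolutely_integrable_continuous_mult[OF cn coefficient_bound_absolutely_integrable]])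
      then show "(\<lambda>t. norm (w t) * coefficient_bound lam t) integrable_on {0..y}"
        by (rule integrable_on_subinterval) (use y in auto)
    qed (rule norm_rhs_le)
    finally show "norm (w y) \<le> integral {0..y} (\<lambda>t. norm (w t) * coefficient_bound lam t)" .
  qed (auto simp: coefficient_bound_nonneg)
  then show ?thesis by simp
qed

text \<open>The coefficients can only be the inverse of \<open>Y 0\<close> applied to
  \<open>y 0\<close>. With this choice the difference of \<open>y\<close> and the combination of
  columns vanishes at 0, hence on the whole interval.\<close>

lemma fundamental_systemI:
  assumes sol: "\<And>l. caratheodory_solution (block_diag_inv blk b) Q lam (\<lambda>x. column l (Y x))"
    and inv: "invertible (Y 0)"
  shows "fundamental_system (block_diag_inv blk b) Q lam Y"
  unfolding fundamental_system_def
proof (intro conjI allI impI sol)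
  fix y assume y: "caratheodory_solution (block_diag_inv blk b) Q lam y"
  have mv: "(\<Sum>l\<in>UNIV. c $ l *s column l (Y x)) = Y x *v c" for c x
    by (simp add: matrix_mult_sum)
  obtain A where A: "Y 0 ** A = mat 1" "A ** Y 0 = mat 1" using inv unfolding invertible_def by blast
  have AC: "absolutely_continuous_on_Icc 0 1 z" if "caratheodory_solution (block_diag_inv blk b) Q lam z" for z
    using that unfolding caratheodory_solution_def by blast
  define c where "c = A *v y 0"
  define w where "w x = y x - (\<Sum>l\<in>UNIV. c $ l *s column l (Y x))" for x
  have cont: "continuous_on {0..1} w" unfolding w_def
    by (intro continuous_intros absolutely_continuous_on_Icc_imp_continuous_on AC y
         bounded_linear.continuous_on[OF bounded_linear_vector_scalar_mult] sol)
  have w0: "w 0 = 0" unfolding w_def mv c_def by (simp add: matrix_vector_mul_assoc A)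
  have int: "((\<lambda>t. rhs lam t (w t)) has_integral w x - w 0) {0..x}" if x: "x \<in> {0..1}" for x
  proof -
    have "((\<lambda>t. rhs lam t (y t) - (\<Sum>l\<in>UNIV. c $ l *s rhs lam t (column l (Y t)))) has_integral
        (y x - y 0) - (\<Sum>l\<in>UNIV. c $ l *s (column l (Y x) - column l (Y 0)))) {0..x}"
      by (intro has_integral_diff has_integral_sum solution_has_integral[OF y x] finite_class.finite_UNIV
           has_integral_linear[OF solution_has_integral[OF sol x] bounded_linear_vector_scalar_mult, unfolded o_def])
    moreover have "rhs lam t (w t) = rhs lam t (y t) - (\<Sum>l\<in>UNIV. c $ l *s rhs lam t (column l (Y t)))" for t
      by (simp add: w_def rhs_diff rhs_sum rhs_smult)
    moreover have "w x - w 0 = (y x - y 0) - (\<Sum>l\<in>UNIV. c $ l *s (column l (Y x) - column l (Y 0)))"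
      by (simp add: w_def vector_ssub_ldistrib sum_subtractf)
    ultimately show ?thesis by simp
  qed
  show "\<exists>!c. \<forall>x\<in>{0..1}. y x = (\<Sum>l\<in>UNIV. c $ l *s column l (Y x))"
  proof (rule ex1I[of _ c])
    show "\<forall>x\<in>{0..1}. y x = (\<Sum>l\<in>UNIV. c $ l *s column l (Y x))"
      using integral_equation_zero[OF cont w0 int] unfolding w_def by simp
    fix c' assume "\<forall>x\<in>{0..1}. y x = (\<Sum>l\<in>UNIV. c' $ l *s column l (Y x))"
    then have "y 0 = Y 0 *v c'" unfolding mv by simp
    then show "c' = c" by (simp add: c_def matrix_vector_mul_assoc A)
  qed
qed

text \<open>
  The diagonal blocks vanish only almost everywhere; they are set to 0 everywhere here, as
  \<open>picard_system\<close> needs.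
\<close>
definition coef :: "'n \<Rightarrow> 'n \<Rightarrow> real \<Rightarrow> complex" where
  "coef i m t = (if blk i = blk m then 0 else - \<i> * b (blk i) * Q t $ i $ m)"

text \<open>The exponential rate of row \<open>i\<close> relative to that of column
  \<open>l\<close>; it takes the place of \<open>\<mu>\<close> in
  \<open>picard_system\<close>.\<close>

definition gap :: "'n \<Rightarrow> 'n \<Rightarrow> complex" where
  "gap l i = \<i> * (b (blk i) - b (blk l))"

lemma gap_eq_0_iff: "gap l i = 0 \<longleftrightarrow> blk i = blk l"
proof -
  have "blk i \<in> {1..r}" "blk l \<in> {1..r}" using blk_range by blast+
  then show ?thesis using b_distinct[of "blk i" "blk l"] unfolding gap_def by auto
qed

lemma coef_absolutely_integrable: "coef i m absolutely_integrable_on {0..1}"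
proof (cases "blk i = blk m")
  case False
  have "(\<lambda>t. (- \<i> * b (blk i)) * Q t $ i $ m) absolutely_integrable_on {0..1}"
    by (intro absolutely_integrable_continuous_mult Q_entry_absolutely_integrable continuous_intros)
  then show ?thesis using False by (simp add: coef_def[abs_def])
qed (simp add: coef_def[abs_def])

lemma rhs_eq_coef:
  assumes "\<And>m. blk i = blk m \<Longrightarrow> Q t $ i $ m = 0"
  shows "rhs lam t v $ i = \<i> * b (blk i) * lam * v $ i + (\<Sum>m\<in>UNIV. coef i m t * v $ m)"
proof -
  have "(\<Sum>m\<in>UNIV. coef i m t * v $ m) = (- \<i> * b (blk i)) * (\<Sum>m\<in>UNIV. Q t $ i $ m * v $ m)"
    unfolding sum_distrib_left by (rule sum.cong) (use assms in \<open>auto simp: coef_def\<close>)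
  then show ?thesis
    by (simp add: rhs_def matrix_vector_mult_def right_diff_distrib mult.assoc)
qed

text \<open>Variation of constants: restoring the factor split off from column \<open>l\<close>
  makes each component an exponential times an indefinite integral of an integrable function. Such a
  product is absolutely continuous, and the product rule recovers the equation almost
  everywhere.\<close>

lemma caratheodory_solutionI:
  fixes w :: "'n \<Rightarrow> real \<Rightarrow> complex"
  assumes cont: "\<And>i. continuous_on {0..1} (w i)"
    and eq: "\<And>i x. x \<in> {0..1} \<Longrightarrow> w i x = exp (gap l i * lam * of_real x) *
      (C i + integral {0..x} (\<lambda>t. exp (- (gap l i * lam * of_real t)) * (\<Sum>m\<in>UNIV. coef i m t * w m t)))"
  shows "caratheodory_solution (block_diag_inv blk b) Q lam (\<lambda>x. \<chi> i. w i x * exp (\<i> * b (blk l) * lam * of_real x))"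
proof -
  define y where "y x = (\<chi> i. w i x * exp (\<i> * b (blk l) * lam * of_real x))" for x
  define h where "h i t = exp (- (gap l i * lam * of_real t)) * (\<Sum>m\<in>UNIV. coef i m t * w m t)" for i t
  define p where "p i x = C i + integral {0..x} (h i)" for i x
  define \<omega> where "\<omega> i = \<i> * b (blk i) * lam" for i
  have expo: "exp (gap l i * lam * of_real x) * exp (\<i> * b (blk l) * lam * of_real x) = exp (\<omega> i * of_real x)" for i x
    unfolding exp_add[symmetric] by (simp add: gap_def \<omega>_def algebra_simps)
  have y: "y x $ i = exp (\<omega> i * of_real x) * p i x" if "x \<in> {0..1}" for i x
    unfolding y_def vec_lambda_beta eq[OF that] p_def h_def expo[symmetric] by (simp add: mult_ac)
  have h: "h i absolutely_integrable_on {0..1}" for i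
  proof -
    have "(\<lambda>t. \<Sum>m\<in>UNIV. w m t * coef i m t) absolutely_integrable_on {0..1}"
      by (intro absolutely_integrable_sum absolutely_integrable_continuous_mult cont coef_absolutely_integrable finite_class.finite_UNIV)
    then have "(\<lambda>t. \<Sum>m\<in>UNIV. coef i m t * w m t) absolutely_integrable_on {0..1}"
      by (simp add: mult.commute)
    then show ?thesis unfolding h_def[abs_def]
      by (intro absolutely_integrable_continuous_mult continuous_intros)
  qed
  have hi: "h i integrable_on {0..1}" for i using h set_lebesgue_integral_eq_integral(1) by blast
  have pAC: "absolutely_continuous_on_Icc 0 1 (p i)" for i
    by (rule absolutely_continuous_on_Icc_indefinite_integralI[OF h]) (simp add: p_def)
  have "absolutely_continuous_on_Icc 0 1 (\<lambda>x. y x $ i)" for i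
  \<comment> \<open>The product form of \<open>y\<close> is known on the unit interval only, so the
    property is transferred through equality of increments there.\<close>
  proof (rule absolutely_continuous_on_Icc_Lipschitz_comp)
    show "absolutely_continuous_on_Icc 0 1 (\<lambda>x. exp (\<omega> i * of_real x) * p i x)"
      by (intro absolutely_continuous_on_Icc_mult absolutely_continuous_on_Icc_exp pAC
          absolutely_continuous_on_Icc_imp_continuous_on)
    show "norm (y v $ i - y u $ i) \<le> 1 * norm (exp (\<omega> i * of_real v) * p i v - exp (\<omega> i * of_real u) * p i u)"
      if "0 \<le> u" "u \<le> v" "v \<le> 1" for u v
      using y[of u i] y[of v i] that by simp
  qed simp
  then have AC: "absolutely_continuous_on_Icc 0 1 y" by (rule absolutely_continuous_on_Icc_vec)
  have "\<exists>N. negligible N \<and> (\<forall>x\<in>{0..1} - N. (p i has_vector_derivative h i x) (at x within {0..1}))" for i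
  proof -
    obtain N where "negligible N" "\<And>x. x \<in> {0..1} - N \<Longrightarrow>
        ((\<lambda>u. integral {0..u} (h i)) has_vector_derivative h i x) (at x within {0..1})"
      using indefinite_integral_has_vector_derivative_ae[OF hi] by blast
    moreover have "(p i has_vector_derivative h i x) (at x within {0..1})"
      if "((\<lambda>u. integral {0..u} (h i)) has_vector_derivative h i x) (at x within {0..1})" for x
      using has_vector_derivative_add[OF has_vector_derivative_const[of "C i"] that] by (simp add: p_def[abs_def])
    ultimately show ?thesis by blast
  qed
  then obtain N where N: "\<And>i. negligible (N i)" "\<And>i x. x \<in> {0..1} - N i \<Longrightarrow> (p i has_vector_derivative h i x) (at x within {0..1})"
    by metis
  have "\<exists>M. negligible M \<and> (\<forall>x\<in>{0..1} - M. blk i = blk m \<longrightarrow> Q x $ i $ m = 0)" for i m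
  proof (cases "blk i = blk m")
    case True
    obtain M where "negligible M" "\<And>x. x \<in> {0..1} - M \<Longrightarrow> Q x $ i $ m = 0"
      using Q_diagonal_zero[OF True] by (rule AE_lebesgue_negligible) blast
    then show ?thesis by blast
  qed auto
  then obtain M where M: "\<And>i m. negligible (M i m)" "\<And>i m x. x \<in> {0..1} - M i m \<Longrightarrow> blk i = blk m \<Longrightarrow> Q x $ i $ m = 0"
    by metis
  \<comment> \<open>Points where some component of the integral is not differentiable with the right
    derivative, or where some entry of a diagonal block of \<open>Q\<close> is nonzero; finitely
    many negligible sets.\<close>
  define A where "A = (\<Union>i. N i) \<union> (\<Union>i. \<Union>m. M i m)"
  have A: "negligible A" unfolding A_def
    by (intro negligible_Un negligible_Union) (auto simp: N M intro!: negligible_Union)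
  have der: "(y has_vector_derivative rhs lam x (y x)) (at x within {0..1})" if x: "x \<in> {0..1} - A" for x
  proof (rule has_vector_derivative_cart)
    fix i
    have Qz: "Q x $ i $ m = 0" if "blk i = blk m" for m using M(2)[of x i m] x that by (auto simp: A_def)
    have "((\<lambda>x. exp (\<omega> i * of_real x)) has_vector_derivative \<omega> i * exp (\<omega> i * of_real x)) (at x within {0..1})"
      by (rule has_vector_derivative_real_field) (auto intro!: derivative_eq_intros)
    moreover have "(p i has_vector_derivative h i x) (at x within {0..1})" by (rule N(2)) (use x in \<open>auto simp: A_def\<close>)
    ultimately have 1: "((\<lambda>x. exp (\<omega> i * of_real x) * p i x) has_vector_derivative
        exp (\<omega> i * of_real x) * h i x + \<omega> i * exp (\<omega> i * of_real x) * p i x) (at x within {0..1})"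
      by (rule has_vector_derivative_mult)
    have ex: "exp (\<omega> i * of_real x) * exp (- (gap l i * lam * of_real x)) = exp (\<i> * b (blk l) * lam * of_real x)"
      unfolding exp_add[symmetric] by (simp add: gap_def \<omega>_def algebra_simps)
    have "exp (\<omega> i * of_real x) * h i x = (\<Sum>m\<in>UNIV. coef i m x * y x $ m)"
      unfolding h_def mult.assoc[symmetric] ex by (simp add: y_def sum_distrib_left mult_ac)
    moreover have "rhs lam x (y x) $ i = \<i> * b (blk i) * lam * y x $ i + (\<Sum>m\<in>UNIV. coef i m x * y x $ m)"
      by (rule rhs_eq_coef) (rule Qz)
    ultimately have "exp (\<omega> i * of_real x) * h i x + \<omega> i * exp (\<omega> i * of_real x) * p i x = rhs lam x (y x) $ i"
      using y[of x i] x by (simp add: \<omega>_def mult.assoc)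
    then show "((\<lambda>x. y x $ i) has_vector_derivative rhs lam x (y x) $ i) (at x within {0..1})"
      using has_vector_derivative_transform[OF _ _ 1, of "\<lambda>x. y x $ i"] y x by auto
  qed
  have "caratheodory_solution (block_diag_inv blk b) Q lam y"
    unfolding caratheodory_solution_def equation_iff_rhs
    using AC der by (intro conjI AE_lebesgueI_negligible[OF A]) auto
  then show ?thesis unfolding y_def[abs_def] .
qed

text \<open>\<open>R\<close> is fixed by the contraction requirement alone and does not depend on
  \<open>e\<close>; a smaller \<open>e\<close> only asks for a larger \<open>norm lam\<close> within
  the same solution family.\<close>

lemma column_asymptotics:
  assumes c: "c > 0"
    and sep: "\<And>j k. j \<in> {1..r} \<Longrightarrow> k \<in> {1..r} \<Longrightarrow> j \<noteq> k \<Longrightarrow>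
      (\<forall>lam\<in>S. Re (\<i> * (b j - b k) * lam) \<ge> c * norm lam) \<or> (\<forall>lam\<in>S. Re (\<i> * (b j - b k) * lam) \<le> - c * norm lam)"
  shows "\<exists>R w.
      (\<forall>lam\<in>outside_disc S R. caratheodory_solution (block_diag_inv blk b) Q lam
         (\<lambda>x. \<chi> i. w lam i x * exp (\<i> * b (blk l) * lam * of_real x))) \<and>
      (\<forall>i. \<forall>x\<in>{0..1}. (\<lambda>lam. w lam i x) analytic_on outside_disc S R) \<and>
      (\<forall>e>0. \<exists>R'. \<forall>lam\<in>outside_disc S R. norm lam > R' \<longrightarrow>
         (\<forall>i. \<forall>x\<in>{0..1}. norm (w lam i x - mat 1 $ i $ l) \<le> e))"
proof -
  define fw where "fw i \<longleftrightarrow> blk i = blk l \<or> (\<forall>lam\<in>S. Re (gap l i * lam) \<le> - c * norm lam)" for i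
  define g where "g t = (\<Sum>i\<in>UNIV. \<Sum>m\<in>UNIV. norm (coef i m t))" for t
  have g0: "g t \<ge> 0" for t unfolding g_def by (intro sum_nonneg norm_ge_zero)
  have "g absolutely_integrable_on {0..1}" unfolding g_def[abs_def]
    by (intro absolutely_integrable_sum absolutely_integrable_norm[unfolded o_def] coef_absolutely_integrable finite_class.finite_UNIV)
  then have g: "g integrable_on {0..1}" by (rule set_lebesgue_integral_eq_integral(1))
  define G where "G = max 1 (integral {0..1} g)"
  have G: "G \<ge> 1" "integral {0..1} g \<le> G" by (auto simp: G_def)
  have G16: "1 / (16 * G) > 0" using G by simp
  obtain T where T: "T > 0" "\<And>\<tau> x. \<tau> \<ge> T \<Longrightarrow> x \<in> {0..1} \<Longrightarrow> integral {0..1} (\<lambda>t. exp (- \<tau> * \<bar>x - t\<bar>) * g t) \<le> 1 / (16 * G)"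
    using exp_kernel_integral_small[OF g g0 G16] by blast
  \<comment> \<open>For \<open>norm lam > R\<close> the decay rate, at least
    \<open>(c/2) * norm lam\<close>, exceeds \<open>T\<close>.\<close>
  define R where "R = 2 * T / c"
  have R: "R > 0" using T c by (simp add: R_def)
  \<comment> \<open>Strict inequalities with \<open>c/2\<close> define an open set, and the nonzero
    points of \<open>S\<close> lie in it because they satisfy the inequality with
    \<open>c\<close>.\<close>
  define HP where "HP i = {lam. if fw i then Re (gap l i * lam) < - (c/2) * norm lam else Re (gap l i * lam) > (c/2) * norm lam}" for i
  define L where "L = {lam. norm lam > R} \<inter> (\<Inter>i\<in>{i. blk i \<noteq> blk l}. HP i)"
  have L_open: "open L"
  proof -
    have "open (HP i)" for i
      unfolding HP_def by (cases "fw i") (auto intro!: open_Collect_less continuous_intros)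
    then show ?thesis unfolding L_def by (intro open_Int open_INT open_Collect_less continuous_intros) auto
  qed
  have SL: "outside_disc S R \<subseteq> L"
  proof
    fix lam assume "lam \<in> outside_disc S R"
    then have lam: "lam \<in> S" "norm lam > R" by (auto simp: outside_disc_def)
    have "lam \<in> HP i" if i: "blk i \<noteq> blk l" for i
    proof -
      have "norm lam > 0" using lam(2) R by linarith
      then have pos: "(c/2) * norm lam < c * norm lam" using c by (intro mult_strict_right_mono) auto
      have il: "blk i \<in> {1..r}" "blk l \<in> {1..r}" using blk_range by blast+
      have "Re (gap l i * lam) < - (c/2) * norm lam" if "fw i"
      proof -
        have "Re (gap l i * lam) \<le> - c * norm lam" using that i lam(1) unfolding fw_def by blast
        then show ?thesis using pos unfolding mult_minus_left by linarith
      qed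
      moreover have "Re (gap l i * lam) > (c/2) * norm lam" if "\<not> fw i"
      proof -
        have "Re (gap l i * lam) \<ge> c * norm lam" using sep[OF il i] that lam(1) unfolding fw_def gap_def by blast
        then show ?thesis using pos by linarith
      qed
      ultimately show ?thesis by (auto simp: HP_def)
    qed
    then show "lam \<in> L" using lam(2) by (auto simp: L_def)
  qed
  have L_gap: "\<bar>Re (gap l i * lam)\<bar> \<ge> (c/2) * norm lam" if "lam \<in> L" "blk i \<noteq> blk l" for lam i
  proof -
    have "lam \<in> HP i" using that by (auto simp: L_def)
    then have *: "if fw i then Re (gap l i * lam) < - (c/2 * norm lam) else Re (gap l i * lam) > c/2 * norm lam"
      unfolding HP_def mem_Collect_eq mult_minus_left .
    show ?thesis
    proof (cases "fw i")
      case True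
      then have "Re (gap l i * lam) < - (c/2 * norm lam)" using * by meson
      then show ?thesis by linarith
    next
      case False
      then have "Re (gap l i * lam) > c/2 * norm lam" using * by meson
      then show ?thesis by linarith
    qed
  qed
  have L_sgn: "if fw i then Re (gap l i * lam) \<le> 0 else Re (gap l i * lam) \<ge> 0" if lam: "lam \<in> L" for lam i
  proof (cases "blk i = blk l")
    case True
    then have "gap l i = 0" by (simp add: gap_eq_0_iff)
    then show ?thesis by simp
  next
    case False
    then have "lam \<in> HP i" using lam by (auto simp: L_def)
    moreover have "(c/2) * norm lam \<ge> 0" using c by simp
    ultimately show ?thesis unfolding HP_def mem_Collect_eq mult_minus_left by (cases "fw i") auto
  qed
  interpret P: picard_system coef "gap l" fw l L G
  proof
    show "coef i m absolutely_integrable_on {0..1}" for i m by (rule coef_absolutely_integrable)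
    show "coef i m t = 0" if "gap l i = 0" "gap l m = 0" for i m t
      using that by (simp add: gap_eq_0_iff coef_def)
    show "gap l l = 0" by (simp add: gap_def)
    show "open L" by (rule L_open)
    show "fw i" if "gap l i = 0" for i using that by (simp add: gap_eq_0_iff fw_def)
    show "Re (gap l i * lam) \<le> 0" if "lam \<in> L" "fw i" for lam i using L_sgn[OF that(1), of i] that(2) by simp
    show "Re (gap l i * lam) \<ge> 0" if "lam \<in> L" "\<not> fw i" for lam i using L_sgn[OF that(1), of i] that(2) by simp
    show "1 \<le> G" by (rule G)
    show "integral {0..1} (\<lambda>t. \<Sum>i\<in>UNIV. \<Sum>m\<in>UNIV. norm (coef i m t)) \<le> G" using G(2) unfolding g_def .
    show "integral {0..1} (\<lambda>t. exp (- \<bar>Re (gap l i * lam)\<bar> * \<bar>x - t\<bar>) * (\<Sum>i\<in>UNIV. \<Sum>m\<in>UNIV. norm (coef i m t))) \<le> 1 / (16 * G)"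
      if "lam \<in> L" "gap l i \<noteq> 0" "x \<in> {0..1}" for lam i x
    proof -
      have "T \<le> (c/2) * norm lam" using that(1) c unfolding L_def R_def by (auto simp: field_simps)
      also have "\<dots> \<le> \<bar>Re (gap l i * lam)\<bar>" using that(2) by (intro L_gap[OF that(1)]) (simp add: gap_eq_0_iff)
      finally show ?thesis using T(2)[OF _ that(3)] unfolding g_def by blast
    qed
  qed
  have kd: "P.kd i = mat 1 $ i $ l" for i by (simp add: P.kd_def mat_def)
  show ?thesis
  proof (rule exI[of _ R], rule exI[of _ P.W], intro conjI ballI allI impI)
    fix lam assume "lam \<in> outside_disc S R"
    then have lam: "lam \<in> L" using SL by blast
    have "\<exists>C. \<forall>x\<in>{0..1}. P.W lam i x = exp (gap l i * lam * of_real x) *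
        (C + integral {0..x} (\<lambda>t. exp (- (gap l i * lam * of_real t)) * (\<Sum>m\<in>UNIV. coef i m t * P.W lam m t)))" for i
      by (rule P.W_eq_indefinite[OF lam, of i]) blast
    then have "\<forall>i. \<exists>C. \<forall>x\<in>{0..1}. P.W lam i x = exp (gap l i * lam * of_real x) *
        (C + integral {0..x} (\<lambda>t. exp (- (gap l i * lam * of_real t)) * (\<Sum>m\<in>UNIV. coef i m t * P.W lam m t)))"
      by (rule allI)
    then obtain C where C: "\<forall>i. \<forall>x\<in>{0..1}. P.W lam i x = exp (gap l i * lam * of_real x) *
        (C i + integral {0..x} (\<lambda>t. exp (- (gap l i * lam * of_real t)) * (\<Sum>m\<in>UNIV. coef i m t * P.W lam m t)))"
      by (rule choice[THEN exE])
    show "caratheodory_solution (block_diag_inv blk b) Q lam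
         (\<lambda>x. \<chi> i. P.W lam i x * exp (\<i> * b (blk l) * lam * of_real x))"
      by (rule caratheodory_solutionI[OF P.W_continuous[OF lam], where C = C]) (use C in blast)
  next
    fix i and x :: real assume "x \<in> {0..1}"
    then have "(\<lambda>lam. P.W lam i x) analytic_on L"
      using P.W_holomorphic L_open analytic_on_open by blast
    then show "(\<lambda>lam. P.W lam i x) analytic_on outside_disc S R"
      using SL analytic_on_subset by blast
  next
    fix e :: real assume e: "e > 0"
    \<comment> \<open>Chosen to cancel the factor 2 G of \<open>P.W_asymptotics\<close>.\<close>
    define e' where "e' = e / (2 * G)"
    have e': "e' > 0" "2 * G * e' = e" using e G(1) by (auto simp: e'_def)
    obtain T' where T': "T' > 0" "\<And>\<tau> x. \<tau> \<ge> T' \<Longrightarrow> x \<in> {0..1} \<Longrightarrow> integral {0..1} (\<lambda>t. exp (- \<tau> * \<bar>x - t\<bar>) * g t) \<le> e'"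
      using exp_kernel_integral_small[OF g g0 e'(1)] by blast
    show "\<exists>R'. \<forall>lam\<in>outside_disc S R. norm lam > R' \<longrightarrow>
        (\<forall>i. \<forall>x\<in>{0..1}. norm (P.W lam i x - mat 1 $ i $ l) \<le> e)"
    proof (intro exI[of _ "2 * T' / c"] ballI allI impI)
      fix lam i and x :: real assume lam: "lam \<in> outside_disc S R" "2 * T' / c < norm lam" and x: "x \<in> {0..1}"
      have lamL: "lam \<in> L" using lam SL by blast
      have "norm (P.W lam i x - P.kd i) \<le> 2 * G * e'"
      proof (rule P.W_asymptotics[OF lamL x])
        fix i and x :: real assume i: "gap l i \<noteq> 0" and x: "x \<in> {0..1}"
        have "T' \<le> (c/2) * norm lam" using lam(2) c by (auto simp: field_simps)
        also have "\<dots> \<le> \<bar>Re (gap l i * lam)\<bar>" using i by (intro L_gap[OF lamL]) (simp add: gap_eq_0_iff)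
        finally show "integral {0..1} (\<lambda>t. exp (- \<bar>Re (gap l i * lam)\<bar> * \<bar>x - t\<bar>) * (\<Sum>i\<in>UNIV. \<Sum>m\<in>UNIV. norm (coef i m t))) \<le> e'"
          using T'(2)[OF _ x] unfolding g_def by blast
      qed (use e' in simp)
      then show "norm (P.W lam i x - mat 1 $ i $ l) \<le> e" unfolding kd e'(2) .
    qed
  qed
qed

end

text \<open>If \<open>M *v x = 0\<close>, then \<open>x\<close> equals minus the image of itself
  under \<open>M - mat 1\<close>, whose norm with respect to the sum of absolute values is at most n
  e < 1, where n is the dimension. So the kernel is trivial.\<close>

lemma invertible_near_identity:
  fixes M :: "complex ^ 'n ^ 'n::finite"
  assumes e: "\<And>i l. norm (M $ i $ l - mat 1 $ i $ l) \<le> e" and small: "real CARD('n) * e < 1"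
  shows "invertible M"
proof -
  have "x = 0" if "M *v x = 0" for x
  proof -
    define s where "s = (\<Sum>i\<in>UNIV. norm (x $ i))"
    have s0: "s \<ge> 0" by (auto simp: s_def intro: sum_nonneg)
    have "norm (x $ i) \<le> e * s" for i
    proof -
      have "(M - mat 1) *v x = - x" using that by (simp add: matrix_vector_mult_diff_rdistrib)
      then have "norm (x $ i) = norm (((M - mat 1) *v x) $ i)" by simp
      also have "\<dots> \<le> (\<Sum>l\<in>UNIV. e * norm (x $ l))"
        unfolding matrix_vector_mult_def vec_lambda_beta
        by (rule sum_norm_le) (use e in \<open>auto simp: norm_mult intro!: mult_right_mono\<close>)
      finally show ?thesis by (simp add: s_def sum_distrib_left)
    qed
    then have "s \<le> (\<Sum>i\<in>(UNIV::'n set). e * s)" unfolding s_def by (rule sum_mono)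
    then have "s \<le> (real CARD('n) * e) * s" by simp
    then have "(1 - real CARD('n) * e) * s \<le> 0" by (simp add: algebra_simps)
    then have "s \<le> 0" using small by (simp add: mult_le_0_iff)
    then have "(\<Sum>i\<in>UNIV. norm (x $ i)) = 0" using s0 by (simp add: s_def)
    then show "x = 0" by (simp add: sum_nonneg_eq_0_iff vec_eq_iff)
  qed
  then show ?thesis using matrix_left_invertible_ker[of M] invertible_left_inverse by blast
qed

theorem proposition2p2:
  fixes r :: nat
    and blk :: "'n::finite \<Rightarrow> nat"
    and b :: "nat \<Rightarrow> complex"
    and B :: "complex ^ 'n ^ 'n"
    and Q :: "real \<Rightarrow> complex ^ 'n ^ 'n"
    and S :: "complex set"
  assumes blocks: "range blk = {1..r}"
    and B_eq: "B = block_diag_inv blk b"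
    and B_nonsingular: "invertible B"
    and b_distinct: "\<And>j k. j \<in> {1..r} \<Longrightarrow> k \<in> {1..r} \<Longrightarrow> j \<noteq> k \<Longrightarrow> b j \<noteq> b k"
    and Q_L1: "Q absolutely_integrable_on {0..1}"
    and Q_diagonal_zero:
      "\<And>i l. blk i = blk l \<Longrightarrow> AE x\<in>{0..1} in lebesgue. Q x $ i $ l = 0"
    and S_sector: "strictly_embedded_sector r b S"
  shows
    "(\<exists>\<sigma>. \<sigma> permutes {1..r} \<and>
        (\<forall>lam\<in>S. strict_mono_on {1..r} (\<lambda>m. Re (\<i> * b (\<sigma> m) * lam)))) \<and>
     (\<forall>\<^sub>F R in at_top. \<exists>Y :: complex \<Rightarrow> real \<Rightarrow> complex ^ 'n ^ 'n.
        (\<forall>lam\<in>outside_disc S R. fundamental_system B Q lam (Y lam)) \<and>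
        (\<forall>x\<in>{0..1}. \<forall>i l. (\<lambda>lam. Y lam x $ i $ l) analytic_on outside_disc S R) \<and>
        (\<exists>E :: complex \<Rightarrow> real \<Rightarrow> complex ^ 'n ^ 'n.
           uniform_limit {0..1} E (\<lambda>x. 0) (inf at_infinity (principal (outside_disc S R))) \<and>
           (\<forall>lam\<in>outside_disc S R. \<forall>x\<in>{0..1}. \<forall>i l.
              (blk i = blk l \<longrightarrow>
                 Y lam x $ i $ l =
                   (mat 1 $ i $ l + E lam x $ i $ l) * exp (\<i> * b (blk l) * lam * complex_of_real x)) \<and>
              (blk i \<noteq> blk l \<longrightarrow>
                 Y lam x $ i $ l =
                   E lam x $ i $ l * exp (\<i> * b (blk l) * lam * complex_of_real x)))))"
proof -
  interpret block_system r blk b Q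
  proof
    show "b (blk i) \<noteq> 0" for i
      using invertible_block_diag_inv B_nonsingular unfolding B_eq .
  qed (use blocks b_distinct Q_L1 Q_diagonal_zero in auto)
  obtain c where c: "c > 0" "\<And>j k. j \<in> {1..r} \<Longrightarrow> k \<in> {1..r} \<Longrightarrow> j \<noteq> k \<Longrightarrow>
      (\<forall>lam\<in>S. Re (\<i> * (b j - b k) * lam) \<ge> c * norm lam) \<or> (\<forall>lam\<in>S. Re (\<i> * (b j - b k) * lam) \<le> - c * norm lam)"
    by (rule strictly_embedded_sector_separation[OF S_sector b_distinct]) auto
  define P where "P l R w \<longleftrightarrow>
      (\<forall>lam\<in>outside_disc S R. caratheodory_solution B Q lam
         (\<lambda>x. \<chi> i. w lam i x * exp (\<i> * b (blk l) * lam * of_real x))) \<and>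
      (\<forall>i. \<forall>x\<in>{0..1}. (\<lambda>lam. w lam i x) analytic_on outside_disc S R) \<and>
      (\<forall>e>0. \<exists>R'. \<forall>lam\<in>outside_disc S R. norm lam > R' \<longrightarrow>
         (\<forall>i. \<forall>x\<in>{0..1}. norm (w lam i x - mat 1 $ i $ l) \<le> e))"
    for l :: 'n and R and w :: "complex \<Rightarrow> 'n \<Rightarrow> real \<Rightarrow> complex"
  have "\<forall>l. \<exists>R w. P l R w"
    using column_asymptotics[OF c] unfolding P_def B_eq by blast
  then obtain Rl w where Pw: "\<And>l. P l (Rl l) (w l)" by metis
  \<comment> \<open>Each column comes with its own radius; there are finitely many columns.\<close>
  define R0 where "R0 = Max (range Rl)"
  have sub: "outside_disc S R \<subseteq> outside_disc S (Rl l)" if "R \<ge> R0" for R l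
  proof -
    have "Rl l \<le> R0" by (simp add: R0_def)
    then show ?thesis using that by (auto simp: outside_disc_def)
  qed
  have sol: "caratheodory_solution B Q lam (\<lambda>x. \<chi> i. w l lam i x * exp (\<i> * b (blk l) * lam * of_real x))"
    if "lam \<in> outside_disc S R" "R \<ge> R0" for lam R l
    using Pw[of l] sub[OF that(2), of l] that(1) unfolding P_def by blast
  have ana: "(\<lambda>lam. w l lam i x) analytic_on outside_disc S R" if "R \<ge> R0" "x \<in> {0..1}" for l i x R
    using Pw[of l] sub[OF that(1), of l] that(2) analytic_on_subset unfolding P_def by blast
  have asym: "\<exists>R'. \<forall>lam\<in>outside_disc S R0. norm lam > R' \<longrightarrow>
         (\<forall>l i. \<forall>x\<in>{0..1}. norm (w l lam i x - mat 1 $ i $ l) \<le> e)" if e: "e > 0" for e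
  proof -
    have "\<forall>l. \<exists>R'. \<forall>lam\<in>outside_disc S (Rl l). norm lam > R' \<longrightarrow>
         (\<forall>i. \<forall>x\<in>{0..1}. norm (w l lam i x - mat 1 $ i $ l) \<le> e)"
      using Pw e unfolding P_def by blast
    then obtain R' where R': "\<forall>l. \<forall>lam\<in>outside_disc S (Rl l). norm lam > R' l \<longrightarrow>
         (\<forall>i. \<forall>x\<in>{0..1}. norm (w l lam i x - mat 1 $ i $ l) \<le> e)" by (rule choice[THEN exE])
    have "R' l \<le> Max (range R')" for l by simp
    then show ?thesis using R' sub[OF order_refl]
      by (intro exI[of _ "Max (range R')"]) (meson le_less_trans subsetD)
  qed
  define n where "n = real CARD('n)"
  have n: "n > 0" by (simp add: n_def)
  \<comment> \<open>With entries off by at most 1/(2 n), \<open>invertible_near_identity\<close>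
    applies because n / (2 n) = 1/2 < 1. At x = 0 the exponential factors are 1, so the bound on
    \<open>w\<close> is a bound on \<open>Y lam 0\<close>.\<close>
  have "1 / (2 * n) > 0" using n by simp
  then obtain R1 where R1: "\<And>lam l i x. lam \<in> outside_disc S R0 \<Longrightarrow> norm lam > R1 \<Longrightarrow> x \<in> {0..1} \<Longrightarrow>
      norm (w l lam i x - mat 1 $ i $ l) \<le> 1 / (2 * n)"
    using asym[of "1 / (2 * n)"] by blast
  define Y :: "complex \<Rightarrow> real \<Rightarrow> complex ^ 'n ^ 'n" where
    "Y lam x = (\<chi> i l. w l lam i x * exp (\<i> * b (blk l) * lam * of_real x))" for lam x
  define E :: "complex \<Rightarrow> real \<Rightarrow> complex ^ 'n ^ 'n" where
    "E lam x = (\<chi> i l. w l lam i x - mat 1 $ i $ l)" for lam x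
  have main: "(\<forall>lam\<in>outside_disc S R. fundamental_system B Q lam (Y lam)) \<and>
        (\<forall>x\<in>{0..1}. \<forall>i l. (\<lambda>lam. Y lam x $ i $ l) analytic_on outside_disc S R) \<and>
        uniform_limit {0..1} E (\<lambda>x. 0) (inf at_infinity (principal (outside_disc S R)))"
    if R: "R \<ge> max R0 R1" for R
  proof (intro conjI ballI allI)
    fix lam assume lam: "lam \<in> outside_disc S R"
    have lam0: "lam \<in> outside_disc S R0" "norm lam > R1" using lam R by (auto simp: outside_disc_def)
    show "fundamental_system B Q lam (Y lam)" unfolding B_eq
    proof (rule fundamental_systemI)
      show "caratheodory_solution (block_diag_inv blk b) Q lam (\<lambda>x. column l (Y lam x))" for l
        using sol[OF lam, of l] R unfolding B_eq by (simp add: Y_def column_def)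
      show "invertible (Y lam 0)"
        by (rule invertible_near_identity[of _ "1 / (2 * n)"])
           (use R1[OF lam0, of 0] n in \<open>auto simp: Y_def n_def\<close>)
    qed
  next
    fix x :: real and i l assume "x \<in> {0..1}"
    then have "(\<lambda>lam. w l lam i x * exp (\<i> * b (blk l) * lam * of_real x)) analytic_on outside_disc S R"
      using R by (intro analytic_intros ana) auto
    then show "(\<lambda>lam. Y lam x $ i $ l) analytic_on outside_disc S R" by (simp add: Y_def)
  next
    show "uniform_limit {0..1} E (\<lambda>x. 0) (inf at_infinity (principal (outside_disc S R)))"
      unfolding uniform_limit_iff eventually_inf_principal eventually_at_infinity
    proof (intro allI impI)
      fix e :: real assume e: "e > 0"
      \<comment> \<open>The norm of a matrix is at most the sum over its n * n entries, so the total
        is e/2.\<close>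
      define e' where "e' = e / (2 * n * n)"
      have e': "e' > 0" using e n by (simp add: e'_def)
      obtain R' where R': "\<And>lam l i x. lam \<in> outside_disc S R0 \<Longrightarrow> norm lam > R' \<Longrightarrow> x \<in> {0..1} \<Longrightarrow>
          norm (w l lam i x - mat 1 $ i $ l) \<le> e'"
        using asym[OF e'] by blast
      have "dist (E lam x) 0 < e" if lam: "norm lam \<ge> R' + 1" "lam \<in> outside_disc S R" and x: "x \<in> {0..1}" for lam x
      proof -
        have lam0: "lam \<in> outside_disc S R0" "norm lam > R'" using lam R by (auto simp: outside_disc_def)
        have "norm (E lam x) \<le> (\<Sum>i\<in>UNIV. norm (E lam x $ i))" by (rule norm_vec_le_sum)
        also have "\<dots> \<le> (\<Sum>i\<in>(UNIV::'n set). \<Sum>l\<in>(UNIV::'n set). norm (E lam x $ i $ l))"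
          by (intro sum_mono norm_vec_le_sum)
        also have "\<dots> \<le> (\<Sum>i\<in>(UNIV::'n set). \<Sum>l\<in>(UNIV::'n set). e')"
          by (intro sum_mono) (use R'[OF lam0 x] in \<open>simp add: E_def\<close>)
        also have "\<dots> = n * n * e'" by (simp add: n_def)
        also have "\<dots> < e" using e n by (simp add: e'_def)
        finally show ?thesis by simp
      qed
      then show "\<exists>b. \<forall>lam. b \<le> norm lam \<longrightarrow> lam \<in> outside_disc S R \<longrightarrow> (\<forall>x\<in>{0..1}. dist (E lam x) 0 < e)"
        by blast
    qed
  qed
  \<comment> \<open>One error matrix serves both cases: outside the diagonal blocks the identity has
    zero entries, so \<open>E\<close> is all that remains.\<close>
  have form: "(blk i = blk l \<longrightarrow> Y lam x $ i $ l = (mat 1 $ i $ l + E lam x $ i $ l) * exp (\<i> * b (blk l) * lam * complex_of_real x)) \<and>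
      (blk i \<noteq> blk l \<longrightarrow> Y lam x $ i $ l = E lam x $ i $ l * exp (\<i> * b (blk l) * lam * complex_of_real x))" for lam x i l
    by (auto simp: Y_def E_def mat_def)
  have "\<exists>Y :: complex \<Rightarrow> real \<Rightarrow> complex ^ 'n ^ 'n.
        (\<forall>lam\<in>outside_disc S R. fundamental_system B Q lam (Y lam)) \<and>
        (\<forall>x\<in>{0..1}. \<forall>i l. (\<lambda>lam. Y lam x $ i $ l) analytic_on outside_disc S R) \<and>
        (\<exists>E :: complex \<Rightarrow> real \<Rightarrow> complex ^ 'n ^ 'n.
           uniform_limit {0..1} E (\<lambda>x. 0) (inf at_infinity (principal (outside_disc S R))) \<and>
           (\<forall>lam\<in>outside_disc S R. \<forall>x\<in>{0..1}. \<forall>i l.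
              (blk i = blk l \<longrightarrow> Y lam x $ i $ l =
                 (mat 1 $ i $ l + E lam x $ i $ l) * exp (\<i> * b (blk l) * lam * complex_of_real x)) \<and>
              (blk i \<noteq> blk l \<longrightarrow> Y lam x $ i $ l =
                 E lam x $ i $ l * exp (\<i> * b (blk l) * lam * complex_of_real x))))"
    if R: "R \<ge> max R0 R1" for R
    by (rule exI[of _ Y], rule conjI[OF main[OF R, THEN conjunct1]],
        rule conjI[OF main[OF R, THEN conjunct2, THEN conjunct1]], rule exI[of _ E],
        rule conjI[OF main[OF R, THEN conjunct2, THEN conjunct2]], intro ballI allI form)
  then show ?thesis
    using strictly_embedded_sector_ordering[OF S_sector b_distinct]
    by (intro conjI eventually_mono[OF eventually_ge_at_top[of "max R0 R1"]])
qed



end
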